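(* Suppose $\lim_{n\to\infty}h_{n-1}/h_n=1$. For $k\ge1$ let $S_n^{(k)}$ be the sum of the elements in all $k$-cycles of $\sigma_n$. (i) $\frac{S_n^{(k)}}{n}\xrightarrow{d}S^{(k)}$ as $n\to\infty$, where the distribution of $S^{(k)}$ is defined by its Laplace transform $$\mathbb E\exp\{-tS^{(k)}\}=\exp\biggl\{\frac{\theta_k}{k}\biggl(\Bigl(\frac{1-e^{-t}}{t}\Bigr)^k-1\biggr)\biggr\},\qquad t>0.$$ (ii) If $k=1$, that is, for $S_n^{(1)}$ being the sum of the fixed points of $\sigma_n$, the limit satisfies $$\mathbb P\{S^{(1)}\le x\}=e^{-\theta_1}\sum_{j=0}^{\lfloor x\rfloor}\frac{(-1)^j}{j!}\bigl(\theta_1(x-j)\bigr)^{j/2}I_j\!\left(2\sqrt{\theta_1(x-j)}\right),\qquad x\ge0,$$ where $I_j$ is the modified Bessel function of the first kind of order $j$.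
   Context: Weighted permutations: let $\theta_k\ge 0$, $k\ge1$. For $\pi$ in the symmetric group $\mathcal S_n$ (permutations of $\{1,\ldots,n\}$) let $C_k(\pi)$ be the number of $k$-cycles of $\pi$. The random permutation $\sigma_n$ has distribution $\mathbb P\{\sigma_n=\pi\}=\frac{1}{h_n n!}\prod_{k=1}^\infty\theta_k^{C_k(\pi)}$, $\pi\in\mathcal S_n$, where $h_n=\frac1{n!}\sum_{\pi\in\mathcal S_n}\prod_{k=1}^\infty\theta_k^{C_k(\pi)}$ is the normalization (the condition $h_{n-1}/h_n\to1$ presupposes $h_n>0$ for all large $n$, which are the $n$ considered). $I_j(z)=\sum_{l=0}^\infty\frac{(z/2)^{2l+j}}{l!\,(l+j)!}$ for integers $j\ge0$; $0^0=1$. $\xrightarrow{d}$ is convergence in distribution. An empty sum is $0$. *)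

theory Defs
  imports "HOL-Probability.Probability" "HOL-Combinatorics.Orbits"
begin

text \<open>
  A permutation of \<open>{1..n}\<close> is a function \<open>p :: nat \<Rightarrow> nat\<close> with \<open>p permutes {1..n}\<close>; it is the
  identity outside \<open>{1..n}\<close>. Its cycles are represented by their supports, i.e. the orbits
  of the points of \<open>{1..n}\<close>; fixed points are the 1-cycles.
\<close>

definition k_cycles :: "nat \<Rightarrow> nat \<Rightarrow> (nat \<Rightarrow> nat) \<Rightarrow> nat set set" where
  "k_cycles n k p = {orbit p x | x. x \<in> {1..n} \<and> card (orbit p x) = k}"

definition cycle_count :: "nat \<Rightarrow> nat \<Rightarrow> (nat \<Rightarrow> nat) \<Rightarrow> nat" where
  "cycle_count n k p = card (k_cycles n k p)"

definition cycle_sum :: "nat \<Rightarrow> nat \<Rightarrow> (nat \<Rightarrow> nat) \<Rightarrow> nat" where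
  "cycle_sum n k p = (\<Sum>c\<in>k_cycles n k p. \<Sum>x\<in>c. x)"

text \<open>The product below runs over all cycle lengths \<open>Suc k \<ge> 1\<close>; the value \<open>\<theta> 0\<close> is never used.\<close>

definition perm_weight :: "(nat \<Rightarrow> real) \<Rightarrow> nat \<Rightarrow> (nat \<Rightarrow> nat) \<Rightarrow> real" where
  "perm_weight \<theta> n p = (\<Prod>k. \<theta> (Suc k) ^ cycle_count n (Suc k) p)"

definition perm_norm :: "(nat \<Rightarrow> real) \<Rightarrow> nat \<Rightarrow> real" where
  "perm_norm \<theta> n = (\<Sum>p | p permutes {1..n}. perm_weight \<theta> n p) / fact n"

definition weighted_random_perm ::
    "(nat \<Rightarrow> real) \<Rightarrow> nat \<Rightarrow> 'a measure \<Rightarrow> ('a \<Rightarrow> nat \<Rightarrow> nat) \<Rightarrow> bool" where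
  "weighted_random_perm \<theta> n M \<sigma> \<longleftrightarrow>
     prob_space M \<and>
     \<sigma> \<in> measurable M (count_space {p. p permutes {1..n}}) \<and>
     (\<forall>p. p permutes {1..n} \<longrightarrow>
        \<P>(\<omega> in M. \<sigma> \<omega> = p) = perm_weight \<theta> n p / (perm_norm \<theta> n * fact n))"

text \<open>
  \<open>\<nu>\<close> is a probability law on the reals whose Laplace transform is the prescribed one. As the
  prescribed values are positive, the integral equation forces integrability.
\<close>

definition cycle_sum_limit_law :: "(nat \<Rightarrow> real) \<Rightarrow> nat \<Rightarrow> real measure \<Rightarrow> bool" where
  "cycle_sum_limit_law \<theta> k \<nu> \<longleftrightarrow>
     real_distribution \<nu> \<and>
     (\<forall>t>0. (LINT x|\<nu>. exp (- t * x)) =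
        exp (\<theta> k / real k * (((1 - exp (- t)) / t) ^ k - 1)))"

definition bessel_I :: "nat \<Rightarrow> real \<Rightarrow> real" where
  "bessel_I j z = (\<Sum>l. (z / 2) ^ (2 * l + j) / (fact l * fact (l + j)))"

lemma k_cycles_eq_empty:
  assumes "p permutes {1..n}" "k > n"
  shows "k_cycles n k p = {}"
proof -
  have "card (orbit p x) \<le> n" if "x \<in> {1..n}" for x
  proof -
    have "orbit p x \<subseteq> {1..n}"
      using permutes_orbit_subset[OF assms(1) that] .
    then show ?thesis
      using card_mono[of "{1..n}" "orbit p x"] by simp
  qed
  then show ?thesis
    using assms(2) by (fastforce simp: k_cycles_def)
qed

lemma perm_weight_eq:
  assumes "p permutes {1..n}"
  shows "perm_weight \<theta> n p = (\<Prod>k=1..n. \<theta> k ^ cycle_count n k p)"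
proof -
  have "(\<Prod>k. \<theta> (Suc k) ^ cycle_count n (Suc k) p) = (\<Prod>k<n. \<theta> (Suc k) ^ cycle_count n (Suc k) p)"
    by (rule prodinf_finite) (auto simp: cycle_count_def k_cycles_eq_empty[OF assms])
  also have "\<dots> = (\<Prod>k=1..n. \<theta> k ^ cycle_count n k p)"
    by (rule prod.reindex_bij_witness[of _ "\<lambda>k. k - 1" Suc]) auto
  finally show ?thesis
    by (simp add: perm_weight_def)
qed

text \<open>
  Because \<open>x / 0 = 0\<close>, convergence of the ratios to 1 already contains the tacit condition that
  the normalization is eventually positive.
\<close>

lemma eventually_perm_norm_pos:
  assumes "\<And>k. k \<ge> 1 \<Longrightarrow> \<theta> k \<ge> 0"
    and "(\<lambda>n. perm_norm \<theta> (n - 1) / perm_norm \<theta> n) \<longlonglongrightarrow> 1"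
  shows "eventually (\<lambda>n. perm_norm \<theta> n > 0) sequentially"
proof -
  have nonneg: "perm_norm \<theta> n \<ge> 0" for n
    unfolding perm_norm_def
    by (intro divide_nonneg_nonneg sum_nonneg) (auto simp: perm_weight_eq assms(1) intro!: prod_nonneg)
  have "eventually (\<lambda>n. perm_norm \<theta> (n - 1) / perm_norm \<theta> n > 0) sequentially"
    using order_tendstoD(1)[OF assms(2), of 0] by simp
  then show ?thesis
    by eventually_elim (use nonneg in \<open>auto simp: zero_less_divide_iff not_less[symmetric]\<close>)
qed

end

theory Submission
  imports Defs "HOL-Real_Asymp.Real_Asymp"
begin

text \<open>
  Summing multiplicative weights over the cycles of all permutations of a finite set obeys a
  recursion over the cycle of a fixed element. It follows that weights which are sums of two
  weights split over subsets: separating the \<open>k\<close>-cycles, the Laplace transform of the sum of their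
  elements becomes a sum over subsets \<open>B\<close> of \<open>{1..n}\<close> of \<open>exp (- t * \<Sum>B / n)\<close> times coefficients
  depending only on \<open>card B\<close>. The mean of these exponentials over \<open>j\<close>-subsets tends to
  \<open>((1 - exp (- t)) / t) ^ j\<close>, since sampling with and without replacement agree in the limit, and the
  hypothesis \<open>h\<^bsub>n-1\<^esub> / h\<^sub>n \<longlonglongrightarrow> 1\<close> lets one pass to the limit in the coefficients by Tannery's theorem.
  The limit law is that of a sum of \<open>k * N\<close> uniform variables on \<open>[0, 1]\<close> with \<open>N\<close> Poisson of mean
  \<open>\<theta>\<^sub>k / k\<close>; for \<open>k = 1\<close> its distribution function is a Poisson mixture of Irwin-Hall distribution
  functions, which is resummed into Bessel functions.
\<close>

section \<open>Sums over permutations of products over cycles\<close>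

text \<open>Formally, the numbers \<open>h_n\<close> are the coefficients of exp (sum of theta_k z^k
  / k). Under the ratio hypothesis this series may diverge at z = 1, so the argument works with
  quotients of coefficients: multiplying the series by an entire function F multiplies the
  coefficients asymptotically by F(1). Isolating the k-cycles means dividing by exp (theta_k z^k /
  k), that is, adding the negative weight -theta_k at length k. This is why the sums over
  permutations are developed for real weights of arbitrary sign. Domination comes from h_(n-j) <= C
  2^j h_n; the base 2 stands for any constant above 1, and it is harmless because the other factor
  is an entire series, absolutely convergent at 2. The limit law is specified by its Laplace
  transform alone, so its support in the half-line has to be extracted from the values of the
  transform. Only then is exp (- X) bounded, and its moments, fed into Taylor expansions of
  characteristic functions and Levy's theorem, yield both convergence and uniqueness.\<close>

definition perm_sum :: "('a set \<Rightarrow> real) \<Rightarrow> 'a set \<Rightarrow> real" where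
  "perm_sum g A = (\<Sum>p | p permutes A. \<Prod>c\<in>orbit p ` A. g c)"

lemma perm_sum_empty [simp]: "perm_sum g {} = 1"
  by (simp add: perm_sum_def)

lemma perm_restrict_cyclic_permutes:
  assumes "p permutes A" "cyclic_on p B"
  shows "perm_restrict p B permutes B"
proof (rule bij_imp_permutes)
  have "finite B"
    using assms(2) by (rule finite_cyclic_on)
  moreover have "p ` B \<subseteq> B"
    using cyclic_on_inI[OF assms(2)] by blast
  moreover have "inj_on p B"
    using permutes_inj[OF assms(1)] by (rule inj_on_subset) simp
  ultimately have "bij_betw p B B"
    by (simp add: bij_betw_def endo_inj_surj)
  then show "bij_betw (perm_restrict p B) B B"
    by (rule bij_betw_cong[THEN iffD1, rotated]) (simp add: perm_restrict_simps)
qed (simp add: perm_restrict_simps)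

text \<open>On \<open>B\<close> the image under \<open>c\<close> stays in \<open>B\<close>, where
  \<open>\<rho>\<close> is the identity; off \<open>B\<close> it is \<open>c\<close> that is the
  identity. So the composition follows one factor on each part.\<close>

lemma orbit_comp_disjoint:
  assumes c: "c permutes B" "orbit c x = B" "x \<in> B" and \<rho>: "\<rho> permutes A - B" and "finite A"
  shows "y \<in> B \<Longrightarrow> orbit (\<rho> \<circ> c) y = B" "y \<in> A - B \<Longrightarrow> orbit (\<rho> \<circ> c) y = orbit \<rho> y"
proof -
  assume y: "y \<in> B"
  have "cyclic_on c B"
    using c by (auto simp: cyclic_on_def)
  have cB: "c z \<in> B" if "z \<in> B" for z
    using permutes_in_image[OF c(1)] that by simp
  have "orbit c y = orbit (\<rho> \<circ> c) y"
  proof (rule orbit_cong0[OF y])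
    show "c z = (\<rho> \<circ> c) z" if "z \<in> B" for z
      using permutes_not_in[OF \<rho>, of "c z"] cB[OF that] by simp
  qed (use cB in blast)
  then show "orbit (\<rho> \<circ> c) y = B"
    using orbit_cyclic_eq3[OF \<open>cyclic_on c B\<close> y] by simp
next
  assume y: "y \<in> A - B"
  have "orbit \<rho> y = orbit (\<rho> \<circ> c) y"
  proof (rule orbit_cong0[OF y])
    show "\<rho> z = (\<rho> \<circ> c) z" if "z \<in> A - B" for z
      using permutes_not_in[OF c(1), of z] that by simp
    show "\<rho> \<in> (A - B) \<rightarrow> (A - B)"
      using permutes_in_image[OF \<rho>] by blast
  qed
  then show "orbit (\<rho> \<circ> c) y = orbit \<rho> y" ..
qed

text \<open>A permutation is cut into its restriction to the cycle \<open>B\<close> and its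
  restriction to the complement; composition inverts this. The number of cyclic permutations of
  \<open>B\<close> stays unevaluated because its value is derived afterwards from this very
  decomposition.\<close>

lemma sum_perms_with_cycle:
  assumes "finite A" "B \<subseteq> A" "x \<in> B"
  shows "(\<Sum>p | p permutes A \<and> orbit p x = B. \<Prod>c\<in>orbit p ` A. g c) =
    real (card {c. c permutes B \<and> orbit c x = B}) * g B * perm_sum g (A - B)"
proof -
  let ?C = "{c. c permutes B \<and> orbit c x = B}"
  have fin: "finite B"
    using assms finite_subset by blast
  have cyc: "cyclic_on p B" if "p permutes A" "orbit p x = B" for p
    using cyclic_on_orbit[OF that(1) assms(1), of x] that by simp
  have "(\<Sum>p | p permutes A \<and> orbit p x = B. \<Prod>c\<in>orbit p ` A. g c) =
      (\<Sum>(c, \<rho>)\<in>?C \<times> {\<rho>. \<rho> permutes A - B}. g B * (\<Prod>c\<in>orbit \<rho> ` (A - B). g c))"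
  proof (rule sum.reindex_bij_witness[of _ "\<lambda>(c, \<rho>). \<rho> \<circ> c"
          "\<lambda>p. (perm_restrict p B, perm_restrict p (A - B))"], goal_cases)
    case (1 p)
    then have p: "p permutes A" "orbit p x = B" by auto
    have "(A - B) \<union> B = A" using assms by auto
    moreover have "(A - B) \<inter> B = {}" by auto
    ultimately show ?case
      using perm_restrict_comp[of "A - B" B p] cyc[OF p] p(1) by simp
  next
    case (2 p)
    then have p: "p permutes A" "orbit p x = B" by auto
    have "orbit (perm_restrict p B) x = orbit p x"
      using assms(3) p(2) by (intro orbit_cong) (auto simp: perm_restrict_simps)
    then show ?case
      using perm_restrict_cyclic_permutes[OF p(1) cyc[OF p]]
        perm_restrict_diff_cyclic[OF p(1) cyc[OF p]] p(2) by simp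
  next
    case (3 b)
    then obtain c \<rho> where b: "b = (c, \<rho>)" "c permutes B" "orbit c x = B" "\<rho> permutes A - B"
      by auto
    have "perm_restrict (\<rho> \<circ> c) B = c"
      using b by (auto simp: fun_eq_iff perm_restrict_def permutes_in_image permutes_not_in)
    moreover have "perm_restrict (\<rho> \<circ> c) (A - B) = \<rho>"
      using b by (auto simp: fun_eq_iff perm_restrict_def permutes_not_in)
    ultimately show ?case
      by (simp add: b)
  next
    case (4 b)
    then obtain c \<rho> where b: "b = (c, \<rho>)" "c permutes B" "orbit c x = B" "\<rho> permutes A - B"
      by auto
    have "\<rho> \<circ> c permutes A"
      using b assms by (intro permutes_compose permutes_subset[of c B A] permutes_subset[of \<rho> "A - B" A]) auto
    then show ?case
      using orbit_comp_disjoint(1)[OF b(2,3) assms(3) b(4) assms(1,3)] b by simp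
  next
    case (5 p)
    then have p: "p permutes A" "orbit p x = B" by auto
    define c where "c = perm_restrict p B"
    define \<rho> where "\<rho> = perm_restrict p (A - B)"
    have c: "c permutes B" unfolding c_def by (rule perm_restrict_cyclic_permutes[OF p(1) cyc[OF p]])
    have cx: "orbit c x = B"
      using assms(3) p(2) unfolding c_def by (subst orbit_cong[of x p]) (auto simp: perm_restrict_simps)
    have \<rho>: "\<rho> permutes A - B"
      unfolding \<rho>_def by (rule perm_restrict_diff_cyclic[OF p(1) cyc[OF p]])
    have "(A - B) \<union> B = A" using assms by auto
    moreover have "(A - B) \<inter> B = {}" by auto
    ultimately have p_eq: "p = \<rho> \<circ> c"
      using perm_restrict_comp[of "A - B" B p] cyc[OF p] p(1) by (simp add: c_def \<rho>_def)
    note orb = orbit_comp_disjoint[OF c cx assms(3) \<rho> assms(1)]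
    have "orbit p ` A = orbit p ` (B \<union> (A - B))"
      using assms by (intro arg_cong[where f = "image _"]) auto
    also have "\<dots> = insert B (orbit \<rho> ` (A - B))"
      unfolding image_Un using assms(3) orb by (auto simp: p_eq)
    finally have "orbit p ` A = insert B (orbit \<rho> ` (A - B))" .
    \<comment> \<open>The product runs over a set of supports, so \<open>g B\<close> splits off as a
      separate factor only if \<open>B\<close> is new.\<close>
    moreover have "B \<notin> orbit \<rho> ` (A - B)"
      using permutes_orbit_subset[OF \<rho>] assms(3) by blast
    ultimately show ?case
      using assms(1) by (simp add: c_def[symmetric] \<rho>_def[symmetric])
  qed
  also have "\<dots> = (\<Sum>c\<in>?C. \<Sum>\<rho> | \<rho> permutes A - B. g B * (\<Prod>c\<in>orbit \<rho> ` (A - B). g c))"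
    unfolding sum.cartesian_product ..
  also have "\<dots> = real (card ?C) * g B * perm_sum g (A - B)"
    by (simp add: perm_sum_def sum_distrib_left mult.assoc)
  finally show ?thesis .
qed

lemma perm_sum_by_cycle:
  assumes "finite A" "x \<in> A"
  shows "perm_sum g A = (\<Sum>B | x \<in> B \<and> B \<subseteq> A.
    real (card {c. c permutes B \<and> orbit c x = B}) * g B * perm_sum g (A - B))"
proof -
  have "perm_sum g A = (\<Sum>B | x \<in> B \<and> B \<subseteq> A. \<Sum>p | p \<in> {p. p permutes A} \<and> orbit p x = B.
      \<Prod>c\<in>orbit p ` A. g c)"
    unfolding perm_sum_def
  proof (rule sum.group[symmetric])
    show "finite {p. p permutes A}" "finite {B. x \<in> B \<and> B \<subseteq> A}"
      using assms(1) by (simp_all add: finite_permutations)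
    show "(\<lambda>p. orbit p x) ` {p. p permutes A} \<subseteq> {B. x \<in> B \<and> B \<subseteq> A}"
      using permutes_orbit_subset assms(2) permutation_self_in_orbit assms(1)
      by (fastforce simp: permutation_permutes)
  qed
  also have "\<dots> = (\<Sum>B | x \<in> B \<and> B \<subseteq> A.
      real (card {c. c permutes B \<and> orbit c x = B}) * g B * perm_sum g (A - B))"
    using assms(1) by (intro sum.cong refl) (simp add: sum_perms_with_cycle)
  finally show ?thesis .
qed

lemma sum_subsets_by_card:
  assumes "finite A"
  shows "(\<Sum>B | B \<subseteq> A. f (card B)) = (\<Sum>j\<le>card A. real (card A choose j) * f j)"
proof -
  have "(\<Sum>B | B \<subseteq> A. f (card B)) = (\<Sum>j\<le>card A. \<Sum>B | B \<in> {B. B \<subseteq> A} \<and> card B = j. f (card B))"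
    using assms by (intro sum.group[symmetric]) (auto intro: card_mono)
  also have "\<dots> = (\<Sum>j\<le>card A. real (card A choose j) * f j)"
    by (intro sum.cong refl) (simp add: n_subsets[OF assms])
  finally show ?thesis .
qed

lemma sum_subsets_containing:
  assumes "finite A" "x \<in> A"
  shows "(\<Sum>B | x \<in> B \<and> B \<subseteq> A. f B) = (\<Sum>B | B \<subseteq> A - {x}. f (insert x B))"
  using assms by (intro sum.reindex_bij_witness[of _ "insert x" "\<lambda>B. B - {x}"]) (auto simp: insert_absorb)

lemma sum_subsets_containing_by_card:
  assumes "finite A" "x \<in> A"
  shows "(\<Sum>B | x \<in> B \<and> B \<subseteq> A. f (card B)) =
    (\<Sum>j<card A. real ((card A - 1) choose j) * f (Suc j))"
proof -
  have "(\<Sum>B | x \<in> B \<and> B \<subseteq> A. f (card B)) = (\<Sum>B | B \<subseteq> A - {x}. f (Suc (card B)))"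
    unfolding sum_subsets_containing[OF assms]
    using assms(1) by (intro sum.cong refl) (subst card_insert_disjoint, auto dest: finite_subset)
  also have "\<dots> = (\<Sum>j\<le>card (A - {x}). real (card (A - {x}) choose j) * f (Suc j))"
    using assms by (intro sum_subsets_by_card[where f = "\<lambda>j. f (Suc j)"]) auto
  also have "{..card (A - {x})} = {..<card A}"
    using card_Suc_Diff1[OF assms] by (simp only: lessThan_Suc_atMost[symmetric])
  finally show ?thesis
    using assms by simp
qed

text \<open>For unit weights the recursion by cycles counts all permutations, which determines the number of
  cyclic ones by induction.\<close>

lemma card_cyclic_perms:
  assumes "finite B" "x \<in> B"
  shows "card {c. c permutes B \<and> orbit c x = B} = fact (card B - 1)"
  using assms
proof (induction B rule: finite_psubset_induct)
  case (psubset B)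
  let ?N = "\<lambda>C. real (card {c. c permutes C \<and> orbit c x = C})"
  have one: "perm_sum (\<lambda>_. 1) C = fact (card C)" if "finite C" for C :: "'a set"
    using that by (simp add: perm_sum_def card_permutations)
  have fin: "finite {C. x \<in> C \<and> C \<subseteq> B}"
    using psubset.hyps by simp
  have split: "{C. x \<in> C \<and> C \<subseteq> B} - {B} = {C. x \<in> C \<and> C \<subset> B}" by auto
  have B: "B \<in> {C. x \<in> C \<and> C \<subseteq> B}" using psubset.prems by simp
  have "fact (card B) = (\<Sum>C | x \<in> C \<and> C \<subseteq> B. ?N C * fact (card (B - C)))"
    unfolding one[OF psubset.hyps, symmetric] perm_sum_by_cycle[OF psubset.hyps psubset.prems]
    using psubset.hyps by (intro sum.cong refl) (subst one, auto)
  also have "\<dots> = ?N B + (\<Sum>C | x \<in> C \<and> C \<subset> B. ?N C * fact (card (B - C)))"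
    unfolding sum.remove[OF fin B] split by simp
  also have "(\<Sum>C | x \<in> C \<and> C \<subset> B. ?N C * fact (card (B - C))) =
      (\<Sum>C | x \<in> C \<and> C \<subset> B. fact (card C - 1) * fact (card B - card C))"
  proof (intro sum.cong refl)
    fix C assume C: "C \<in> {C. x \<in> C \<and> C \<subset> B}"
    then have "finite C"
      using psubset.hyps finite_subset by blast
    then show "?N C * fact (card (B - C)) = fact (card C - 1) * fact (card B - card C)"
      using C psubset.IH[of C] by (simp add: card_Diff_subset psubset_imp_subset)
  qed
  also have "\<dots> = (\<Sum>C | x \<in> C \<and> C \<subseteq> B. fact (card C - 1) * fact (card B - card C)) - fact (card B - 1)"
    unfolding sum.remove[OF fin B] split by simp
  also have "(\<Sum>C | x \<in> C \<and> C \<subseteq> B. fact (card C - 1) * fact (card B - card C)) =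
      (\<Sum>j<card B. real ((card B - 1) choose j) * (fact (Suc j - 1) * fact (card B - Suc j)))"
    using psubset.hyps psubset.prems
    by (rule sum_subsets_containing_by_card[where f = "\<lambda>j. fact (j - 1) * fact (card B - j)"])
  \<comment> \<open>With the claimed count inserted for every \<open>C\<close>, including
    \<open>B\<close>, each size contributes (card B - 1)! and the total is (card B)!. The true count
    for \<open>B\<close> must therefore agree with the inserted one.\<close>
  also have "\<dots> = (\<Sum>j<card B. fact (card B - 1))"
  proof (intro sum.cong refl)
    fix j assume "j \<in> {..<card B}"
    then have "fact j * fact (card B - 1 - j) * ((card B - 1) choose j) = (fact (card B - 1) :: nat)"
      by (intro binomial_fact_lemma) auto
    then have "real (fact j * fact (card B - 1 - j) * ((card B - 1) choose j)) = real (fact (card B - 1))"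
      by (simp only:)
    then show "real ((card B - 1) choose j) * (fact (Suc j - 1) * fact (card B - Suc j)) = fact (card B - 1)"
      by (simp add: mult_ac)
  qed
  also have "\<dots> = fact (card B)"
    using psubset.hyps psubset.prems by (cases "card B") auto
  finally have "?N B = real (fact (card B - 1))"
    by simp
  then show ?case
    unfolding of_nat_eq_iff .
qed

lemma perm_sum_rec:
  assumes "finite A" "x \<in> A"
  shows "perm_sum g A = (\<Sum>B | x \<in> B \<and> B \<subseteq> A. fact (card B - 1) * g B * perm_sum g (A - B))"
  unfolding perm_sum_by_cycle[OF assms]
proof (intro sum.cong refl)
  fix B assume B: "B \<in> {B. x \<in> B \<and> B \<subseteq> A}"
  then have "finite B"
    using assms finite_subset by blast
  with B show "real (card {c. c permutes B \<and> orbit c x = B}) * g B * perm_sum g (A - B) =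
      fact (card B - 1) * g B * perm_sum g (A - B)"
    by (simp add: card_cyclic_perms)
qed

lemma sum_nested_subsets:
  assumes "finite A" "x \<in> A"
  shows "(\<Sum>B | x \<in> B \<and> B \<subseteq> A. \<Sum>C | x \<in> C \<and> C \<subseteq> B. f C (B - C)) =
    (\<Sum>C | x \<in> C \<and> C \<subseteq> A. \<Sum>D | D \<subseteq> A - C. f C D)"
proof -
  have fin: "finite B" if "B \<subseteq> A" for B using that assms finite_subset by blast
  show ?thesis
    by (subst (1 2) sum.Sigma)
      (use assms fin in \<open>auto intro!: sum.reindex_bij_witness[of _ "\<lambda>(C, D). (C \<union> D, C)" "\<lambda>(B, C). (C, B - C)"]\<close>)
qed

text \<open>The inner sum over permutations of \<open>B\<close> is expanded along the cycle
  \<open>C\<close> through \<open>x\<close>, and the order of summation is exchanged with D = B - C.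
  \<open>G\<close> is arbitrary so that either colour can be the one containing
  \<open>x\<close>.\<close>

lemma sum_perm_sum_rec:
  assumes "finite A" "x \<in> A"
  shows "(\<Sum>B | x \<in> B \<and> B \<subseteq> A. perm_sum u B * G (A - B)) =
    (\<Sum>C | x \<in> C \<and> C \<subseteq> A.
      fact (card C - 1) * u C * (\<Sum>D | D \<subseteq> A - C. perm_sum u D * G (A - C - D)))"
proof -
  have "(\<Sum>B | x \<in> B \<and> B \<subseteq> A. perm_sum u B * G (A - B)) =
      (\<Sum>B | x \<in> B \<and> B \<subseteq> A. \<Sum>C | x \<in> C \<and> C \<subseteq> B.
        fact (card C - 1) * u C * (perm_sum u (B - C) * G (A - C - (B - C))))"
  proof (intro sum.cong refl)
    fix B assume B: "B \<in> {B. x \<in> B \<and> B \<subseteq> A}"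
    have xB: "finite B" "x \<in> B"
      using B assms(1) by (auto intro: finite_subset)
    have "A - C - (B - C) = A - B" if "C \<subseteq> B" for C
      using that by blast
    then show "perm_sum u B * G (A - B) = (\<Sum>C | x \<in> C \<and> C \<subseteq> B.
        fact (card C - 1) * u C * (perm_sum u (B - C) * G (A - C - (B - C))))"
      unfolding perm_sum_rec[OF xB, of u] sum_distrib_right
      by (intro sum.cong refl) (simp only: mem_Collect_eq mult.assoc)
  qed
  also have "\<dots> = (\<Sum>C | x \<in> C \<and> C \<subseteq> A. \<Sum>D | D \<subseteq> A - C.
      fact (card C - 1) * u C * (perm_sum u D * G (A - C - D)))"
    by (rule sum_nested_subsets[OF assms])
  finally show ?thesis
    unfolding sum_distrib_left .
qed

text \<open>Colouring the cycles with two colours splits the ground set into the two unions of cycles.\<close>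

lemma perm_sum_add:
  assumes "finite A"
  shows "perm_sum (\<lambda>C. g C + h C) A = (\<Sum>B | B \<subseteq> A. perm_sum g B * perm_sum h (A - B))"
  using assms
proof (induction A rule: finite_psubset_induct)
  case (psubset A)
  show ?case
  proof (cases "A = {}")
    case True
    have "{B :: 'a set. B = {}} = {{}}" by auto
    then show ?thesis
      by (simp add: True)
  next
    case False
    then obtain x where x: "x \<in> A" by auto
    let ?\<gamma> = "\<lambda>C :: 'a set. fact (card C - 1) :: real"
    let ?P = "\<lambda>u v A. \<Sum>B | B \<subseteq> A. perm_sum u B * perm_sum v (A - B)"
    let ?Q = "\<lambda>u v. \<Sum>B | x \<in> B \<and> B \<subseteq> A. perm_sum u B * perm_sum v (A - B)"
    have swap: "?P h g D = ?P g h D" for D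
      by (rule sum.reindex_bij_witness[of _ "\<lambda>B. D - B" "\<lambda>B. D - B"]) (auto simp: double_diff)
    \<comment> \<open>Split according to the colour of the cycle through \<open>x\<close>: either
      \<open>x\<close> lies in \<open>B\<close>, or it lies in the complement, and complementation
      turns the second case into the first with the colours exchanged.\<close>
    have "?P g h A = ?Q g h + (\<Sum>B | x \<notin> B \<and> B \<subseteq> A. perm_sum g B * perm_sum h (A - B))"
      using psubset.hyps by (subst sum.union_disjoint[symmetric]) (auto intro!: sum.cong)
    also have "(\<Sum>B | x \<notin> B \<and> B \<subseteq> A. perm_sum g B * perm_sum h (A - B)) = ?Q h g"
      by (rule sum.reindex_bij_witness[of _ "\<lambda>B. A - B" "\<lambda>B. A - B"]) (use x in \<open>auto simp: double_diff\<close>)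
    also have "?Q g h = (\<Sum>C | x \<in> C \<and> C \<subseteq> A. ?\<gamma> C * g C * ?P g h (A - C))"
      by (rule sum_perm_sum_rec[OF psubset.hyps x])
    also have "?Q h g = (\<Sum>C | x \<in> C \<and> C \<subseteq> A. ?\<gamma> C * h C * ?P h g (A - C))"
      by (rule sum_perm_sum_rec[OF psubset.hyps x])
    also have "(\<Sum>C | x \<in> C \<and> C \<subseteq> A. ?\<gamma> C * g C * ?P g h (A - C)) + \<dots> =
        (\<Sum>C | x \<in> C \<and> C \<subseteq> A. ?\<gamma> C * (g C + h C) * perm_sum (\<lambda>C. g C + h C) (A - C))"
      unfolding sum.distrib[symmetric]
    proof (intro sum.cong refl)
      fix C assume "C \<in> {C. x \<in> C \<and> C \<subseteq> A}"
      then have "A - C \<subset> A" using x by auto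
      from psubset.IH[OF this]
      show "?\<gamma> C * g C * ?P g h (A - C) + ?\<gamma> C * h C * ?P h g (A - C) =
          ?\<gamma> C * (g C + h C) * perm_sum (\<lambda>C. g C + h C) (A - C)"
        unfolding swap by (simp only: distrib_left distrib_right)
    qed
    also have "\<dots> = perm_sum (\<lambda>C. g C + h C) A"
      by (rule perm_sum_rec[OF psubset.hyps x, symmetric])
    finally show ?thesis ..
  qed
qed

text \<open>Each element lies in exactly one cycle, so a factor attached to elements comes out of
  the whole sum. This is how the exponentials leave the sum over permutations.\<close>

lemma perm_sum_prod_weight:
  assumes "finite A"
  shows "perm_sum (\<lambda>C. (\<Prod>x\<in>C. y x) * g C) A = (\<Prod>x\<in>A. y x) * perm_sum g A"
  using assms
proof (induction A rule: finite_psubset_induct)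
  case (psubset A)
  show ?case
  proof (cases "A = {}")
    case False
    then obtain x where x: "x \<in> A" by auto
    have "perm_sum (\<lambda>C. prod y C * g C) A =
        (\<Sum>B | x \<in> B \<and> B \<subseteq> A. prod y A * (fact (card B - 1) * g B * perm_sum g (A - B)))"
      unfolding perm_sum_rec[OF psubset.hyps x]
    proof (intro sum.cong refl)
      fix B assume B: "B \<in> {B. x \<in> B \<and> B \<subseteq> A}"
      have "perm_sum (\<lambda>C. prod y C * g C) (A - B) = prod y (A - B) * perm_sum g (A - B)"
        using B x by (intro psubset.IH) auto
      moreover have "prod y A = prod y (A - B) * prod y B"
        using B psubset.hyps by (intro prod.subset_diff) auto
      ultimately show "fact (card B - 1) * (prod y B * g B) * perm_sum (\<lambda>C. prod y C * g C) (A - B) =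
          prod y A * (fact (card B - 1) * g B * perm_sum g (A - B))"
        by (simp only: mult_ac)
    qed
    then show ?thesis
      unfolding perm_sum_rec[OF psubset.hyps x, of g] sum_distrib_left .
  qed auto
qed

section \<open>Normalization coefficients\<close>

text \<open>These are the coefficients of H(z) = exp (sum of theta_k z^k / k). The recursion
  compares coefficients in z H'(z) = (sum of theta_k z^k) H(z).\<close>

fun weight_coeff :: "(nat \<Rightarrow> real) \<Rightarrow> nat \<Rightarrow> real" where
  "weight_coeff \<theta> 0 = 1"
| "weight_coeff \<theta> (Suc n) = (\<Sum>j\<le>n. \<theta> (Suc j) * weight_coeff \<theta> (n - j)) / real (Suc n)"

text \<open>For a set of size m + 1 there are (m choose j) supports of size j + 1 through
  \<open>x\<close>, with j! cyclic permutations each; together with the (m - j)! from the complement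
  this is m!, whatever j is. What remains is the recursion of \<open>weight_coeff\<close>.\<close>

lemma perm_sum_card:
  assumes "finite A"
  shows "perm_sum (\<lambda>C. \<theta> (card C)) A = fact (card A) * weight_coeff \<theta> (card A)"
  using assms
proof (induction A rule: finite_psubset_induct)
  case (psubset A)
  show ?case
  proof (cases "A = {}")
    case False
    then obtain x where x: "x \<in> A" by auto
    obtain m where m: "card A = Suc m"
      using psubset.hyps False by (cases "card A") auto
    define f where "f j = fact (j - 1) * \<theta> j * (fact (card A - j) * weight_coeff \<theta> (card A - j))" for j
    have "perm_sum (\<lambda>C. \<theta> (card C)) A = (\<Sum>B | x \<in> B \<and> B \<subseteq> A. f (card B))"
      unfolding perm_sum_rec[OF psubset.hyps x]
    proof (intro sum.cong refl)
      fix B assume B: "B \<in> {B. x \<in> B \<and> B \<subseteq> A}"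
      then have "finite B" "A - B \<subset> A"
        using psubset.hyps x by (auto intro: finite_subset)
      with psubset.IH[of "A - B"] B
      show "fact (card B - 1) * \<theta> (card B) * perm_sum (\<lambda>C. \<theta> (card C)) (A - B) = f (card B)"
        by (simp add: f_def card_Diff_subset)
    qed
    also have "\<dots> = (\<Sum>j<card A. real ((card A - 1) choose j) * f (Suc j))"
      by (rule sum_subsets_containing_by_card[OF psubset.hyps x])
    also have "\<dots> = (\<Sum>j\<le>m. fact m * (\<theta> (Suc j) * weight_coeff \<theta> (m - j)))"
      unfolding m lessThan_Suc_atMost
    proof (intro sum.cong refl)
      fix j assume "j \<in> {..m}"
      then have "real (m choose j) * (fact j * fact (m - j)) = fact m"
        by (simp add: binomial_fact)
      then show "real ((Suc m - 1) choose j) * f (Suc j) = fact m * (\<theta> (Suc j) * weight_coeff \<theta> (m - j))"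
        by (simp add: f_def m mult_ac)
    qed
    also have "\<dots> = fact (card A) * weight_coeff \<theta> (card A)"
      unfolding sum_distrib_left[symmetric] m by (simp add: field_simps)
    finally show ?thesis .
  qed simp
qed

lemma weight_coeff_nonneg:
  assumes "\<And>k. k \<ge> 1 \<Longrightarrow> \<theta> k \<ge> 0"
  shows "weight_coeff \<theta> n \<ge> 0"
proof (induction n rule: less_induct)
  case (less n)
  then show ?case
    by (cases n) (auto intro!: divide_nonneg_nonneg sum_nonneg mult_nonneg_nonneg assms)
qed

lemma weight_coeff_cong:
  assumes "\<And>k. k \<ge> 1 \<Longrightarrow> \<theta> k = \<theta>' k"
  shows "weight_coeff \<theta> n = weight_coeff \<theta>' n"
proof (induction n rule: less_induct)
  case (less n)
  then show ?case
    by (cases n) (auto intro!: sum.cong simp: assms)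
qed

lemma sum_binomial_fact:
  "(\<Sum>j\<le>n. real (n choose j) * (fact j * a j * (fact (n - j) * b j))) = fact n * (\<Sum>j\<le>n. a j * b j)"
  unfolding sum_distrib_left by (intro sum.cong refl) (simp add: binomial_fact)

text \<open>This is exp (a + b) = exp a * exp b for the generating series, read off from the
  two-colouring of cycles on a set of size n.\<close>

lemma weight_coeff_add:
  "weight_coeff (\<lambda>k. \<theta> k + \<theta>' k) n = (\<Sum>j\<le>n. weight_coeff \<theta> j * weight_coeff \<theta>' (n - j))"
proof -
  let ?A = "{..<n}"
  have "fact n * weight_coeff (\<lambda>k. \<theta> k + \<theta>' k) n =
      (\<Sum>B | B \<subseteq> ?A. perm_sum (\<lambda>C. \<theta> (card C)) B * perm_sum (\<lambda>C. \<theta>' (card C)) (?A - B))"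
    using perm_sum_card[of ?A "\<lambda>k. \<theta> k + \<theta>' k"]
      perm_sum_add[of ?A "\<lambda>C. \<theta> (card C)" "\<lambda>C. \<theta>' (card C)"] by simp
  also have "\<dots> = (\<Sum>B | B \<subseteq> ?A. fact (card B) * weight_coeff \<theta> (card B) *
      (fact (n - card B) * weight_coeff \<theta>' (n - card B)))"
  proof (intro sum.cong refl)
    fix B assume B: "B \<in> {B. B \<subseteq> ?A}"
    then have "finite B" by (auto intro: finite_subset)
    then show "perm_sum (\<lambda>C. \<theta> (card C)) B * perm_sum (\<lambda>C. \<theta>' (card C)) (?A - B) =
        fact (card B) * weight_coeff \<theta> (card B) * (fact (n - card B) * weight_coeff \<theta>' (n - card B))"
      using B by (simp add: perm_sum_card card_Diff_subset)
  qed
  also have "\<dots> = fact n * (\<Sum>j\<le>n. weight_coeff \<theta> j * weight_coeff \<theta>' (n - j))"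
    using sum_subsets_by_card[of ?A
        "\<lambda>j. fact j * weight_coeff \<theta> j * (fact (n - j) * weight_coeff \<theta>' (n - j))"]
    by (simp add: sum_binomial_fact)
  finally show ?thesis by simp
qed

text \<open>Adding this to \<open>\<theta>(k := 0)\<close> with c = theta_k recovers
  \<open>\<theta>\<close>; adding it to \<open>\<theta>\<close> with c = -theta_k deletes the
  k-cycles.\<close>

definition single_weight :: "nat \<Rightarrow> real \<Rightarrow> nat \<Rightarrow> real" where
  "single_weight k c j = (if j = k then c else 0)"

text \<open>The generating series is exp (c z^k / k). In the recursion a single term survives, and
  at n = k q it contributes the factor c / (k q), so q steps build the power and the
  factorial.\<close>

lemma weight_coeff_single:
  assumes "k \<ge> 1"
  shows "weight_coeff (single_weight k c) n =
    (if k dvd n then (c / real k) ^ (n div k) / fact (n div k) else 0)"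
proof (induction n rule: less_induct)
  case (less n)
  show ?case
  proof (cases n)
    case (Suc m)
    have "(\<Sum>j\<le>m. single_weight k c (Suc j) * weight_coeff (single_weight k c) (m - j)) =
        (\<Sum>j\<le>m. if k - 1 = j then c * weight_coeff (single_weight k c) (m - j) else 0)"
      using assms by (intro sum.cong refl) (auto simp: single_weight_def)
    also have "\<dots> = (if k \<le> n then c * weight_coeff (single_weight k c) (n - k) else 0)"
      using assms Suc by (subst sum.delta') auto
    finally have eq: "weight_coeff (single_weight k c) n =
        (if k \<le> n then c * weight_coeff (single_weight k c) (n - k) else 0) / real n"
      unfolding Suc by simp
    show ?thesis
    proof (cases "k \<le> n")
      case True
      have dvd: "k dvd n - k \<longleftrightarrow> k dvd n"
        using True by (simp add: dvd_minus_self)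
      have IH: "weight_coeff (single_weight k c) (n - k) =
          (if k dvd n then (c / real k) ^ ((n - k) div k) / fact ((n - k) div k) else 0)"
        using less.IH[of "n - k"] assms Suc dvd by simp
      show ?thesis
      proof (cases "k dvd n")
        case dvd_n: True
        then obtain q where q: "n = k * q" by auto
        then obtain q' where q': "q = Suc q'"
          using Suc by (cases q) auto
        have "(n - k) div k = q'" "n div k = Suc q'" "real n = real k * real (Suc q')"
          using assms q q' by (simp_all add: algebra_simps)
        then show ?thesis
          using True dvd_n assms unfolding eq IH by simp
      qed (simp add: eq IH)
    next
      case False
      moreover have "\<not> k dvd n"
        using False Suc by (auto dest: dvd_imp_le)
      ultimately show ?thesis
        by (simp add: eq)
    qed
  qed simp
qed

text \<open>Convergence for every real \<open>y\<close> matters: y = 2 serves the domination, y = 1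
  the deletion of k-cycles, and y = (1 - exp (- t)) / t the limit itself.\<close>

lemma weight_coeff_single_sums:
  assumes "k \<ge> 1"
  shows "(\<lambda>n. weight_coeff (single_weight k c) n * y ^ n) sums exp (c / real k * y ^ k)"
proof -
  have "strict_mono (\<lambda>m. k * m)"
    using assms by (intro strict_monoI) simp
  moreover have "weight_coeff (single_weight k c) n * y ^ n = 0" if "n \<notin> range (\<lambda>m. k * m)" for n
    using that assms by (auto simp: weight_coeff_single)
  ultimately have "(\<lambda>m. weight_coeff (single_weight k c) (k * m) * y ^ (k * m)) sums exp (c / real k * y ^ k) \<longleftrightarrow>
      (\<lambda>n. weight_coeff (single_weight k c) n * y ^ n) sums exp (c / real k * y ^ k)"
    by (rule sums_mono_reindex)
  moreover have "weight_coeff (single_weight k c) (k * m) * y ^ (k * m) =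
      (c / real k * y ^ k) ^ m /\<^sub>R fact m" for m
    using assms by (simp add: weight_coeff_single power_mult power_mult_distrib power_divide field_simps)
  ultimately show ?thesis
    using exp_converges[of "c / real k * y ^ k"] by simp
qed

section \<open>From weighted permutations to sums over subsets\<close>

lemma k_cycles_altdef: "k_cycles n k p = {c \<in> orbit p ` {1..n}. card c = k}"
  by (auto simp: k_cycles_def)

lemma perm_weight_eq_prod:
  assumes "p permutes {1..n}"
  shows "perm_weight \<theta> n p = (\<Prod>c\<in>orbit p ` {1..n}. \<theta> (card c))"
proof -
  have "card c \<in> {1..n}" if "c \<in> orbit p ` {1..n}" for c
  proof -
    have "c \<subseteq> {1..n}" "c \<noteq> {}"
      using that permutes_orbit_subset[OF assms] orbit_nonempty[of p] by blast+
    then show ?thesis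
      using card_mono[of "{1..n}" c] finite_subset[of c "{1..n}"] by (auto simp: Suc_le_eq card_gt_0_iff)
  qed
  then have "(\<Prod>c\<in>orbit p ` {1..n}. \<theta> (card c)) =
      (\<Prod>k=1..n. \<Prod>c | c \<in> orbit p ` {1..n} \<and> card c = k. \<theta> (card c))"
    by (intro prod.group[symmetric]) auto
  also have "\<dots> = (\<Prod>k=1..n. \<theta> k ^ cycle_count n k p)"
    by (intro prod.cong refl) (simp add: cycle_count_def k_cycles_altdef)
  finally show ?thesis
    by (simp add: perm_weight_eq[OF assms])
qed

lemma perm_norm_eq_weight_coeff: "perm_norm \<theta> n = weight_coeff \<theta> n"
proof -
  have "(\<Sum>p | p permutes {1..n}. perm_weight \<theta> n p) = perm_sum (\<lambda>C. \<theta> (card C)) {1..n}"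
    unfolding perm_sum_def by (intro sum.cong refl) (simp add: perm_weight_eq_prod)
  then show ?thesis
    by (simp add: perm_norm_def perm_sum_card)
qed

text \<open>The j-th elementary symmetric polynomial in exp (- s), ..., exp (- s n).\<close>

definition subset_exp_sum :: "real \<Rightarrow> nat \<Rightarrow> nat \<Rightarrow> real" where
  "subset_exp_sum s n j = (\<Sum>B | B \<subseteq> {1..n} \<and> card B = j. \<Prod>x\<in>B. exp (- s * real x))"

text \<open>The factor of a cycle is a sum of two weights: one lives on supports of size k and
  carries the exponentials of its elements, the other on all remaining sizes. Colouring splits the
  ground set into the part \<open>B\<close> covered by k-cycles and the rest; apart from the
  exponentials over \<open>B\<close>, only the size of \<open>B\<close> enters.\<close>

lemma sum_perm_weight_exp:
  assumes "k \<ge> 1"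
  shows "(\<Sum>p | p permutes {1..n}. perm_weight \<theta> n p * exp (- s * real (cycle_sum n k p))) =
    (\<Sum>j\<le>n. subset_exp_sum s n j * (fact j * fact (n - j)) *
      (weight_coeff (single_weight k (\<theta> k)) j * weight_coeff (\<theta>(k := 0)) (n - j)))"
proof -
  let ?A = "{1..n}"
  let ?y = "\<lambda>x. exp (- s * real x)"
  let ?g = "\<lambda>C :: nat set. prod ?y C * single_weight k (\<theta> k) (card C)"
  let ?h = "\<lambda>C :: nat set. (\<theta>(k := 0)) (card C)"
  let ?F = "\<lambda>j. (fact j * fact (n - j)) *
      (weight_coeff (single_weight k (\<theta> k)) j * weight_coeff (\<theta>(k := 0)) (n - j))"
  have "perm_weight \<theta> n p * exp (- s * real (cycle_sum n k p)) = (\<Prod>c\<in>orbit p ` ?A. ?g c + ?h c)"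
    if "p permutes ?A" for p
  proof -
    have "exp (- s * real (cycle_sum n k p)) = (\<Prod>c\<in>k_cycles n k p. prod ?y c)"
    proof -
      have fin: "finite c" if "c \<in> k_cycles n k p" for c
        using that assms by (intro card_ge_0_finite) (auto simp: k_cycles_altdef)
      have "finite (k_cycles n k p)"
        by (simp add: k_cycles_altdef)
      then show ?thesis
        unfolding cycle_sum_def of_nat_sum sum_distrib_left by (simp add: exp_sum fin)
    qed
    also have "\<dots> = (\<Prod>c\<in>orbit p ` ?A. if card c = k then prod ?y c else 1)"
      unfolding k_cycles_altdef by (intro prod.inter_filter) auto
    finally have "perm_weight \<theta> n p * exp (- s * real (cycle_sum n k p)) =
        (\<Prod>c\<in>orbit p ` ?A. \<theta> (card c) * (if card c = k then prod ?y c else 1))"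
      by (simp add: perm_weight_eq_prod[OF that] prod.distrib)
    also have "\<dots> = (\<Prod>c\<in>orbit p ` ?A. ?g c + ?h c)"
      by (intro prod.cong refl) (auto simp: single_weight_def)
    finally show ?thesis .
  qed
  then have "(\<Sum>p | p permutes ?A. perm_weight \<theta> n p * exp (- s * real (cycle_sum n k p))) =
      perm_sum (\<lambda>C. ?g C + ?h C) ?A"
    unfolding perm_sum_def by (intro sum.cong refl) auto
  also have "\<dots> = (\<Sum>B | B \<subseteq> ?A. perm_sum ?g B * perm_sum ?h (?A - B))"
    by (rule perm_sum_add) simp
  also have "\<dots> = (\<Sum>B | B \<subseteq> ?A. prod ?y B * ?F (card B))"
  proof (intro sum.cong refl)
    fix B assume B: "B \<in> {B. B \<subseteq> ?A}"
    then have fin: "finite B" by (auto intro: finite_subset)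
    show "perm_sum ?g B * perm_sum ?h (?A - B) = prod ?y B * ?F (card B)"
      using B unfolding perm_sum_prod_weight[OF fin]
      by (simp only: perm_sum_card[OF fin] perm_sum_card[OF finite_Diff[OF finite_atLeastAtMost]])
        (simp add: card_Diff_subset[OF fin])
  qed
  also have "\<dots> = (\<Sum>j\<le>n. \<Sum>B | B \<in> {B. B \<subseteq> ?A} \<and> card B = j. prod ?y B * ?F (card B))"
  proof (rule sum.group[symmetric])
    show "card ` {B. B \<subseteq> ?A} \<subseteq> {..n}"
      using card_mono[of ?A] by auto
  qed auto
  also have "\<dots> = (\<Sum>j\<le>n. subset_exp_sum s n j * ?F j)"
    unfolding subset_exp_sum_def sum_distrib_right by (intro sum.cong) auto
  finally show ?thesis
    by (simp add: mult.assoc)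
qed

section \<open>Asymptotics of the Laplace transform\<close>

text \<open>A set \<open>D\<close> of size j + 1 arises from exactly j + 1 pairs, one for each
  choice of the inserted element.\<close>

lemma sum_pairs_insert:
  assumes "finite A"
  shows "(\<Sum>B | B \<subseteq> A \<and> card B = j. \<Sum>x\<in>A - B. f (insert x B)) =
    real (Suc j) * (\<Sum>D | D \<subseteq> A \<and> card D = Suc j. f D)"
proof -
  have fin: "finite B" if "B \<subseteq> A" for B
    using that assms by (rule finite_subset)
  have "(\<Sum>B | B \<subseteq> A \<and> card B = j. \<Sum>x\<in>A - B. f (insert x B)) =
      (\<Sum>D | D \<subseteq> A \<and> card D = Suc j. \<Sum>x\<in>D. f D)"
    using assms fin
    by (subst (1 2) sum.Sigma)
      (auto simp: insert_absorb
        intro!: sum.reindex_bij_witness[of _ "\<lambda>(D, x). (D - {x}, x)" "\<lambda>(B, x). (insert x B, x)"])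
  also have "\<dots> = real (Suc j) * (\<Sum>D | D \<subseteq> A \<and> card D = Suc j. f D)"
    unfolding sum_distrib_left by (intro sum.cong refl) auto
  finally show ?thesis .
qed

text \<open>Multiplying an elementary symmetric polynomial by the first power sum gives (j + 1)
  times the next one plus the terms with a repeated index. These number j * (n choose j), and each
  lies in [0, 1].\<close>

lemma subset_exp_sum_rec:
  assumes "s \<ge> 0"
  shows "\<bar>subset_exp_sum s n j * (\<Sum>x=1..n. exp (- s * real x)) -
    real (Suc j) * subset_exp_sum s n (Suc j)\<bar> \<le> real j * real n ^ j"
proof -
  let ?A = "{1..n}"
  let ?y = "\<lambda>x. exp (- s * real x)"
  let ?S = "{B. B \<subseteq> ?A \<and> card B = j}"
  let ?R = "\<Sum>B\<in>?S. \<Sum>x\<in>B. prod ?y B * ?y x"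
  have fin: "finite B" if "B \<in> ?S" for B
    using that by (auto intro: finite_subset)
  have "subset_exp_sum s n j * sum ?y ?A = (\<Sum>B\<in>?S. \<Sum>x\<in>?A. prod ?y B * ?y x)"
    unfolding subset_exp_sum_def by (rule sum_product)
  also have "\<dots> = (\<Sum>B\<in>?S. (\<Sum>x\<in>?A - B. prod ?y B * ?y x) + (\<Sum>x\<in>B. prod ?y B * ?y x))"
    by (intro sum.cong refl sum.subset_diff) auto
  also have "\<dots> = (\<Sum>B\<in>?S. \<Sum>x\<in>?A - B. prod ?y (insert x B)) + ?R"
    unfolding sum.distrib using fin by (intro arg_cong2[of _ _ _ _ "(+)"] sum.cong refl) auto
  also have "(\<Sum>B\<in>?S. \<Sum>x\<in>?A - B. prod ?y (insert x B)) = real (Suc j) * subset_exp_sum s n (Suc j)"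
    unfolding subset_exp_sum_def by (rule sum_pairs_insert) simp
  finally have eq: "subset_exp_sum s n j * sum ?y ?A - real (Suc j) * subset_exp_sum s n (Suc j) = ?R"
    by simp
  have le1: "prod ?y B * ?y x \<le> 1" for B x
    using assms by (intro mult_le_one prod_le_1 prod_nonneg) auto
  have "?R \<le> (\<Sum>B\<in>?S. \<Sum>x\<in>B. 1)"
    by (intro sum_mono le1)
  also have "\<dots> = real j * real (n choose j)"
    using n_subsets[of ?A j] by simp
  also have "real (n choose j) \<le> real n ^ j"
  proof (cases "j \<le> n")
    case True
    then show ?thesis
      using binomial_le_pow[of j n] by (metis of_nat_le_iff of_nat_power)
  qed (simp add: binomial_eq_0)
  finally have "?R \<le> real j * real n ^ j"
    by (simp add: mult_left_mono)
  moreover have "?R \<ge> 0"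
    by (intro sum_nonneg mult_nonneg_nonneg prod_nonneg) auto
  ultimately show ?thesis
    unfolding eq by simp
qed

lemma subset_exp_sum_limit:
  assumes "t \<ge> 0" and lim: "(\<lambda>n. (\<Sum>x=1..n. exp (- (t / real n) * real x)) / real n) \<longlonglongrightarrow> \<phi>"
  shows "(\<lambda>n. subset_exp_sum (t / real n) n j / real n ^ j) \<longlonglongrightarrow> \<phi> ^ j / fact j"
proof (induction j)
  case 0
  have "{B. B \<subseteq> {1..n} \<and> card B = 0} = {{}}" for n :: nat
    by (auto simp: finite_subset card_eq_0_iff)
  then have "subset_exp_sum s n 0 = 1" for s n
    by (simp add: subset_exp_sum_def)
  then show ?case
    by simp
next
  case (Suc j)
  let ?e = "\<lambda>j n. subset_exp_sum (t / real n) n j"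
  let ?p = "\<lambda>n. \<Sum>x=1..n. exp (- (t / real n) * real x)"
  have "(\<lambda>n. ?e j n / real n ^ j * (?p n / real n) - real (Suc j) * (?e (Suc j) n / real n ^ Suc j)) \<longlonglongrightarrow> 0"
  proof (rule Lim_null_comparison)
    show "(\<lambda>n. real j / real n) \<longlonglongrightarrow> 0"
      by real_asymp
    show "\<forall>\<^sub>F n in sequentially. norm (?e j n / real n ^ j * (?p n / real n) -
        real (Suc j) * (?e (Suc j) n / real n ^ Suc j)) \<le> real j / real n"
      using eventually_gt_at_top[of 0]
    proof eventually_elim
      case (elim n)
      have "?e j n / real n ^ j * (?p n / real n) - real (Suc j) * (?e (Suc j) n / real n ^ Suc j) =
          (?e j n * ?p n - real (Suc j) * ?e (Suc j) n) / real n ^ Suc j"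
        by (simp add: diff_divide_distrib mult.commute)
      also have "norm \<dots> \<le> real j * real n ^ j / real n ^ Suc j"
        unfolding real_norm_def abs_divide
        using elim subset_exp_sum_rec[of "t / real n" n j] assms(1)
        by (intro frac_le) auto
      finally show ?case
        using elim by simp
    qed
  qed
  then have "(\<lambda>n. (?e j n / real n ^ j * (?p n / real n) -
      (?e j n / real n ^ j * (?p n / real n) - real (Suc j) * (?e (Suc j) n / real n ^ Suc j))) / real (Suc j))
      \<longlonglongrightarrow> (\<phi> ^ j / fact j * \<phi> - 0) / real (Suc j)"
    by (intro tendsto_intros Suc.IH lim) auto
  also have "(\<phi> ^ j / fact j * \<phi> - 0) / real (Suc j) = \<phi> ^ Suc j / fact (Suc j)"
    by (simp add: field_simps)
  finally show ?case
    by (simp del: of_nat_Suc power_Suc fact_Suc)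
qed

text \<open>A Riemann sum for the integral of exp (- t u) over [0, 1], evaluated as a geometric
  sum.\<close>

lemma geometric_mean_limit:
  assumes "(t::real) > 0"
  shows "(\<lambda>n. (\<Sum>x=1..n. exp (- (t / real n) * real x)) / real n) \<longlonglongrightarrow> (1 - exp (- t)) / t"
proof (rule Lim_transform_eventually)
  show "(\<lambda>n. exp (- t / real n) * (1 - exp (- t)) / ((1 - exp (- t / real n)) * real n)) \<longlonglongrightarrow> (1 - exp (- t)) / t"
    using assms by (real_asymp simp: field_simps)
  show "\<forall>\<^sub>F n in sequentially. exp (- t / real n) * (1 - exp (- t)) / ((1 - exp (- t / real n)) * real n) =
      (\<Sum>x=1..n. exp (- (t / real n) * real x)) / real n"
    using eventually_gt_at_top[of 0]
  proof eventually_elim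
    case (elim n)
    let ?q = "exp (- t / real n)"
    have "?q \<noteq> 1"
      using assms elim by simp
    have "(\<Sum>x=1..n. exp (- (t / real n) * real x)) = (\<Sum>x=1..n. ?q ^ x)"
      by (intro sum.cong refl) (simp add: exp_of_nat_mult[symmetric] mult.commute)
    also have "\<dots> = ?q * (\<Sum>x<n. ?q ^ x)"
      unfolding sum_distrib_left by (rule sum.reindex_bij_witness[of _ Suc "\<lambda>x. x - 1"]) (auto simp: power_eq_if)
    also have "(\<Sum>x<n. ?q ^ x) = (1 - ?q ^ n) / (1 - ?q)"
      using \<open>?q \<noteq> 1\<close> by (simp add: sum_gp_strict)
    also have "?q ^ n = exp (- t)"
      using elim by (simp add: exp_of_nat_mult[symmetric])
    finally show ?case
      by simp
  qed
qed

text \<open>The limit for \<open>t\<close> is divided by the limit for t = 0, where the sum is the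
  number of subsets; the powers of n and the factorial of j cancel.\<close>

lemma subset_exp_mean_limit:
  assumes "t > 0"
  shows "(\<lambda>n. subset_exp_sum (t / real n) n j * (fact j * fact (n - j)) / fact n) \<longlonglongrightarrow>
    ((1 - exp (- t)) / t) ^ j"
proof -
  let ?\<phi> = "(1 - exp (- t)) / t"
  have "(\<lambda>n. (\<Sum>x=1..n. exp (- (0 / real n) * real x)) / real n) \<longlonglongrightarrow> 1"
    by (rule tendsto_eventually) (use eventually_gt_at_top[of 0] in eventually_elim, simp)
  moreover have "subset_exp_sum 0 n j = real (n choose j)" for n
    using n_subsets[of "{1..n}" j] by (simp add: subset_exp_sum_def)
  ultimately have "(\<lambda>n. real (n choose j) / real n ^ j) \<longlonglongrightarrow> 1 / fact j"
    using subset_exp_sum_limit[of 0 1 j] by simp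
  from tendsto_divide[OF subset_exp_sum_limit[OF less_imp_le[OF assms] geometric_mean_limit[OF assms], of j] this]
  have "(\<lambda>n. (subset_exp_sum (t / real n) n j / real n ^ j) / (real (n choose j) / real n ^ j))
      \<longlonglongrightarrow> (?\<phi> ^ j / fact j) / (1 / fact j)"
    by simp
  then have "(\<lambda>n. subset_exp_sum (t / real n) n j * (fact j * fact (n - j)) / fact n) \<longlonglongrightarrow>
      (?\<phi> ^ j / fact j) / (1 / fact j)"
  proof (rule Lim_transform_eventually)
    show "\<forall>\<^sub>F n in sequentially. (subset_exp_sum (t / real n) n j / real n ^ j) / (real (n choose j) / real n ^ j) =
        subset_exp_sum (t / real n) n j * (fact j * fact (n - j)) / fact n"
      using eventually_gt_at_top[of j]
      by eventually_elim (simp add: binomial_fact)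
  qed
  then show ?thesis
    by simp
qed

text \<open>An average of numbers in [0, 1]; the bound is uniform in n and j, as domination
  requires.\<close>

lemma subset_exp_mean_bounds:
  assumes "s \<ge> 0" "j \<le> n"
  shows "0 \<le> subset_exp_sum s n j * (fact j * fact (n - j)) / fact n"
    and "subset_exp_sum s n j * (fact j * fact (n - j)) / fact n \<le> 1"
proof -
  show "0 \<le> subset_exp_sum s n j * (fact j * fact (n - j)) / fact n"
    unfolding subset_exp_sum_def
    by (intro divide_nonneg_nonneg mult_nonneg_nonneg sum_nonneg prod_nonneg) auto
  have "subset_exp_sum s n j \<le> (\<Sum>B | B \<subseteq> {1..n} \<and> card B = j. 1)"
    unfolding subset_exp_sum_def using assms(1) by (intro sum_mono prod_le_1) auto
  also have "\<dots> = fact n / (fact j * fact (n - j))"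
    using n_subsets[of "{1..n}" j] assms(2) by (simp add: binomial_fact)
  finally show "subset_exp_sum s n j * (fact j * fact (n - j)) / fact n \<le> 1"
    by (simp add: field_simps)
qed

section \<open>Quotients of coefficients under convolution\<close>

lemma ratio_limit_shift:
  fixes a :: "nat \<Rightarrow> real"
  assumes "(\<lambda>n. a (n - 1) / a n) \<longlonglongrightarrow> 1" and "eventually (\<lambda>n. a n > 0) sequentially"
  shows "(\<lambda>n. a (n - j) / a n) \<longlonglongrightarrow> 1"
proof (induction j)
  case 0
  show ?case
    by (rule tendsto_eventually) (use assms(2) in eventually_elim, simp)
next
  case (Suc j)
  have shift: "filterlim (\<lambda>n. n - j) at_top sequentially"
    by (rule filterlim_minus_const_nat_at_top)
  have "(\<lambda>n. a (n - j - 1) / a (n - j) * (a (n - j) / a n)) \<longlonglongrightarrow> 1 * 1"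
    by (intro tendsto_mult Suc.IH filterlim_compose[OF assms(1) shift])
  moreover have "eventually (\<lambda>n. a (n - j) > 0) sequentially"
    using filterlim_iff[THEN iffD1, OF shift] assms(2) by blast
  then have "\<forall>\<^sub>F n in sequentially. a (n - j - 1) / a (n - j) * (a (n - j) / a n) = a (n - Suc j) / a n"
    by eventually_elim simp
  ultimately show ?case
    using Lim_transform_eventually by fastforce
qed

text \<open>Beyond \<open>N\<close> the quotient a (n - 1) / a n is below 2, so each step backwards
  costs at most a factor 2; the finitely many indices up to \<open>N\<close> are absorbed into
  \<open>C\<close>.\<close>

lemma ratio_limit_bound:
  fixes a :: "nat \<Rightarrow> real"
  assumes lim: "(\<lambda>n. a (n - 1) / a n) \<longlonglongrightarrow> 1" and pos: "eventually (\<lambda>n. a n > 0) sequentially"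
  obtains N C where "\<And>n. n \<ge> N \<Longrightarrow> a n > 0" "\<And>n i. n \<ge> N \<Longrightarrow> i \<le> n \<Longrightarrow> a i \<le> C * 2 ^ (n - i) * a n"
proof -
  have "\<forall>\<^sub>F n in sequentially. a n > 0 \<and> a (n - 1) / a n < 2"
    using pos order_tendstoD(2)[OF lim, of 2] by (auto elim: eventually_elim2)
  then obtain N where N: "\<And>n. n \<ge> N \<Longrightarrow> a n > 0 \<and> a (n - 1) / a n < 2"
    by (auto simp: eventually_at_top_linorder)
  \<comment> \<open>The maximum includes the index \<open>N\<close>, which gives
    \<open>C \<ge> 1\<close>; the diagonal case i = n of the induction relies on this.\<close>
  define C where "C = Max ((\<lambda>i. \<bar>a i\<bar> / a N) ` {..N})"
  have C: "\<bar>a i\<bar> / a N \<le> C" if "i \<le> N" for i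
    unfolding C_def using that by (intro Max_ge) auto
  have aN: "a N > 0"
    using N by blast
  have "C \<ge> 1"
    using C[of N] aN by simp
  have "a i \<le> C * 2 ^ (n - i) * a n" if "n \<ge> N" "i \<le> n" for n i
    using that
  proof (induction n arbitrary: i rule: dec_induct)
    case base
    have "a i \<le> C * 1 * a N"
      using C[OF base] aN by (simp add: pos_divide_le_eq)
    also have "\<dots> \<le> C * 2 ^ (N - i) * a N"
      using aN \<open>C \<ge> 1\<close> by (intro mult_right_mono mult_left_mono) auto
    finally show ?case .
  next
    case (step n)
    have an: "a (Suc n) > 0" "a n \<le> 2 * a (Suc n)"
      using N[of "Suc n"] step.hyps by (auto simp: pos_divide_less_eq)
    show ?case
    proof (cases "i \<le> n")
      case True
      have "a i \<le> C * 2 ^ (n - i) * a n"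
        using step.IH True .
      also have "\<dots> \<le> C * 2 ^ (n - i) * (2 * a (Suc n))"
        using an \<open>C \<ge> 1\<close> by (intro mult_left_mono) auto
      finally show ?thesis
        using True by (simp add: Suc_diff_le)
    next
      case False
      then show ?thesis
        using step.prems \<open>C \<ge> 1\<close> an(1) by (simp add: le_Suc_eq)
    qed
  qed
  with N that show ?thesis by blast
qed

text \<open>Each summand converges because a (n - j) / a n tends to 1, and the growth bound
  dominates it by a multiple of \<open>\<bar>\<alpha> j\<bar> * 2 ^ j\<close>, uniformly in
  n.\<close>

lemma convolution_ratio_limit:
  fixes a b \<alpha> :: "nat \<Rightarrow> real" and u :: "nat \<Rightarrow> nat \<Rightarrow> real"
  assumes lim: "(\<lambda>n. a (n - 1) / a n) \<longlonglongrightarrow> 1" and pos: "eventually (\<lambda>n. a n > 0) sequentially"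
    and b: "\<And>i. \<bar>b i\<bar> \<le> a i" "(\<lambda>n. b n / a n) \<longlonglongrightarrow> L"
    and u: "\<And>n j. j \<le> n \<Longrightarrow> \<bar>u n j\<bar> \<le> 1" "\<And>j. (\<lambda>n. u n j) \<longlonglongrightarrow> v j"
    and \<alpha>: "summable (\<lambda>j. \<bar>\<alpha> j\<bar> * 2 ^ j)"
  shows "(\<lambda>n. (\<Sum>j\<le>n. u n j * (\<alpha> j * b (n - j))) / a n) \<longlonglongrightarrow> (\<Sum>j. v j * \<alpha> j * L)"
proof -
  obtain N C where N: "\<And>n. n \<ge> N \<Longrightarrow> a n > 0"
      "\<And>n i. n \<ge> N \<Longrightarrow> i \<le> n \<Longrightarrow> a i \<le> C * 2 ^ (n - i) * a n"
    by (rule ratio_limit_bound[OF lim pos]) blast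
  \<comment> \<open>Extending by 0 beyond j = n turns the finite convolutions into series over a
    fixed index set, the form Tannery's theorem takes.\<close>
  define f where "f j n = (if j \<le> n then u n j * \<alpha> j * (b (n - j) / a n) else 0)" for j n
  have f_eq: "(\<Sum>j. f j n) = (\<Sum>j\<le>n. u n j * (\<alpha> j * b (n - j))) / a n" for n
  proof -
    have "(\<Sum>j. f j n) = (\<Sum>j\<le>n. f j n)"
      by (rule suminf_finite) (auto simp: f_def)
    also have "\<dots> = (\<Sum>j\<le>n. u n j * (\<alpha> j * b (n - j))) / a n"
      unfolding sum_divide_distrib by (intro sum.cong refl) (simp add: f_def)
    finally show ?thesis .
  qed
  have "(\<lambda>n. f j n) \<longlonglongrightarrow> v j * \<alpha> j * L" for j
  proof -
    have shift: "filterlim (\<lambda>n. n - j) at_top sequentially"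
      by (rule filterlim_minus_const_nat_at_top)
    have "(\<lambda>n. b (n - j) / a (n - j) * (a (n - j) / a n)) \<longlonglongrightarrow> L * 1"
      by (rule tendsto_mult[OF filterlim_compose[OF b(2) shift] ratio_limit_shift[OF lim pos]])
    moreover have "eventually (\<lambda>n. a (n - j) > 0) sequentially"
      using filterlim_iff[THEN iffD1, OF shift] pos by blast
    then have "\<forall>\<^sub>F n in sequentially. b (n - j) / a (n - j) * (a (n - j) / a n) = b (n - j) / a n"
      by eventually_elim simp
    ultimately have "(\<lambda>n. b (n - j) / a n) \<longlonglongrightarrow> L * 1"
      by (rule Lim_transform_eventually)
    then have "(\<lambda>n. u n j * \<alpha> j * (b (n - j) / a n)) \<longlonglongrightarrow> v j * \<alpha> j * L"
      unfolding mult_1_right by (intro tendsto_mult u(2) tendsto_const)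
    moreover have "\<forall>\<^sub>F n in sequentially. u n j * \<alpha> j * (b (n - j) / a n) = f j n"
      using eventually_ge_at_top[of j] by eventually_elim (simp add: f_def)
    ultimately show ?thesis
      by (rule Lim_transform_eventually)
  qed
  moreover have "norm (f j n) \<le> \<bar>C\<bar> * (\<bar>\<alpha> j\<bar> * 2 ^ j)" if "n \<ge> N" for j n
  proof (cases "j \<le> n")
    case True
    have "\<bar>b (n - j)\<bar> \<le> C * 2 ^ j * a n"
      using b(1)[of "n - j"] N(2)[OF that, of "n - j"] True by simp
    also have "\<dots> \<le> \<bar>C\<bar> * 2 ^ j * a n"
      using N(1)[OF that] by (intro mult_right_mono) auto
    finally have "\<bar>b (n - j)\<bar> / a n \<le> \<bar>C\<bar> * 2 ^ j"
      using N(1)[OF that] by (simp add: pos_divide_le_eq)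
    then have "\<bar>u n j\<bar> * \<bar>\<alpha> j\<bar> * (\<bar>b (n - j)\<bar> / a n) \<le> 1 * \<bar>\<alpha> j\<bar> * (\<bar>C\<bar> * 2 ^ j)"
      using u(1)[OF True] N(1)[OF that] by (intro mult_mono) auto
    then show ?thesis
      using True N(1)[OF that] by (simp add: f_def abs_mult mult_ac)
  qed (simp add: f_def)
  then have "\<forall>\<^sub>F (j, n) in sequentially \<times>\<^sub>F sequentially. norm (f j n) \<le> \<bar>C\<bar> * (\<bar>\<alpha> j\<bar> * 2 ^ j)"
    unfolding eventually_prod_filter
    by (intro exI[of _ "\<lambda>_. True"] exI[of _ "\<lambda>n. n \<ge> N"]) (auto intro: eventually_ge_at_top)
  moreover have "summable (\<lambda>j. \<bar>C\<bar> * (\<bar>\<alpha> j\<bar> * 2 ^ j))"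
    by (intro summable_mult \<alpha>)
  ultimately have "(\<lambda>n. \<Sum>j. f j n) \<longlonglongrightarrow> (\<Sum>j. v j * \<alpha> j * L)"
    using tannerys_theorem[of f "\<lambda>j. v j * \<alpha> j * L" sequentially "\<lambda>j. \<bar>C\<bar> * (\<bar>\<alpha> j\<bar> * 2 ^ j)"] by auto
  then show ?thesis
    by (simp add: f_eq)
qed

lemma summable_weight_coeff_single:
  assumes "k \<ge> 1"
  shows "summable (\<lambda>j. \<bar>weight_coeff (single_weight k c) j\<bar> * 2 ^ j)"
proof -
  have "\<bar>weight_coeff (single_weight k c) j\<bar> = weight_coeff (single_weight k \<bar>c\<bar>) j" for j
    using assms by (simp add: weight_coeff_single power_abs)
  then show ?thesis
    using sums_summable[OF weight_coeff_single_sums[OF assms, of "\<bar>c\<bar>" 2]] by simp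
qed

context
  fixes \<theta> :: "nat \<Rightarrow> real" and k :: nat
  assumes theta_nonneg: "\<And>k. k \<ge> 1 \<Longrightarrow> \<theta> k \<ge> 0"
    and ratio: "(\<lambda>n. perm_norm \<theta> (n - 1) / perm_norm \<theta> n) \<longlonglongrightarrow> 1"
    and k: "k \<ge> 1"
begin

text \<open>Deleting the k-cycles multiplies the generating series by exp (- theta_k z^k / k), and
  the limit is the value of this factor at z = 1. Here the convolution limit is applied with a = b
  and u = 1.\<close>

lemma weight_coeff_removed_limit:
  "(\<lambda>n. weight_coeff (\<theta>(k := 0)) n / perm_norm \<theta> n) \<longlonglongrightarrow> exp (- \<theta> k / real k)"
proof -
  let ?\<alpha> = "weight_coeff (single_weight k (- \<theta> k))"
  have pos: "\<forall>\<^sub>F n in sequentially. perm_norm \<theta> n > 0"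
    by (rule eventually_perm_norm_pos[OF _ ratio]) (rule theta_nonneg)
  have "(\<lambda>n. perm_norm \<theta> n / perm_norm \<theta> n) \<longlonglongrightarrow> 1"
    by (rule tendsto_eventually) (use pos in eventually_elim, simp)
  then have "(\<lambda>n. (\<Sum>j\<le>n. 1 * (?\<alpha> j * perm_norm \<theta> (n - j))) / perm_norm \<theta> n) \<longlonglongrightarrow> (\<Sum>j. 1 * ?\<alpha> j * 1)"
    by (intro convolution_ratio_limit[OF ratio pos] summable_weight_coeff_single k)
      (auto simp: perm_norm_eq_weight_coeff weight_coeff_nonneg[OF theta_nonneg])
  moreover have "weight_coeff (\<theta>(k := 0)) n = (\<Sum>j\<le>n. ?\<alpha> j * perm_norm \<theta> (n - j))" for n
  proof -
    have "weight_coeff (\<theta>(k := 0)) n = weight_coeff (\<lambda>j. single_weight k (- \<theta> k) j + \<theta> j) n"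
      by (rule weight_coeff_cong) (simp add: single_weight_def)
    then show ?thesis
      by (simp add: weight_coeff_add perm_norm_eq_weight_coeff)
  qed
  moreover have "(\<Sum>j. ?\<alpha> j) = exp (- \<theta> k / real k)"
    using sums_unique[OF weight_coeff_single_sums[OF k, of "- \<theta> k" 1]] by simp
  ultimately show ?thesis
    by simp
qed

text \<open>The left side is the term j = 0 of a convolution of nonnegative coefficients that adds
  up to the right side. It supplies the bound \<open>\<bar>b i\<bar> \<le> a i\<close> for the
  convolution limit.\<close>

lemma weight_coeff_removed_le: "weight_coeff (\<theta>(k := 0)) n \<le> perm_norm \<theta> n"
proof -
  have nonneg: "weight_coeff (\<theta>(k := 0)) i \<ge> 0" "weight_coeff (single_weight k (\<theta> k)) i \<ge> 0" for i
    using theta_nonneg by (auto intro!: weight_coeff_nonneg simp: single_weight_def)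
  have "weight_coeff (\<theta>(k := 0)) n =
      (\<Sum>j\<in>{0}. weight_coeff (single_weight k (\<theta> k)) j * weight_coeff (\<theta>(k := 0)) (n - j))"
    by simp
  also have "\<dots> \<le> (\<Sum>j\<le>n. weight_coeff (single_weight k (\<theta> k)) j * weight_coeff (\<theta>(k := 0)) (n - j))"
    by (rule sum_mono2) (auto intro!: mult_nonneg_nonneg nonneg)
  also have "\<dots> = weight_coeff (\<lambda>j. single_weight k (\<theta> k) j + (\<theta>(k := 0)) j) n"
    by (rule weight_coeff_add[symmetric])
  also have "\<dots> = perm_norm \<theta> n"
    unfolding perm_norm_eq_weight_coeff by (rule weight_coeff_cong) (simp add: single_weight_def)
  finally show ?thesis .
qed

text \<open>With \<open>\<phi>\<close> = (1 - exp (- t)) / t, the averages over j-subsets tend to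
  \<open>\<phi>\<close> ^ j, so the limit is the generating series exp (theta_k z^k / k) at z =
  \<open>\<phi>\<close>, times the factor exp (- theta_k / k) from the cycles of other
  lengths.\<close>

lemma laplace_cycle_sum_limit:
  assumes "t > 0"
  shows "(\<lambda>n. (\<Sum>p | p permutes {1..n}.
      perm_weight \<theta> n p * exp (- t * (real (cycle_sum n k p) / real n))) / (perm_norm \<theta> n * fact n))
    \<longlonglongrightarrow> exp (\<theta> k / real k * (((1 - exp (- t)) / t) ^ k - 1))"
proof -
  let ?\<phi> = "(1 - exp (- t)) / t"
  let ?\<alpha> = "weight_coeff (single_weight k (\<theta> k))"
  let ?\<beta> = "weight_coeff (\<theta>(k := 0))"
  let ?u = "\<lambda>n j. subset_exp_sum (t / real n) n j * (fact j * fact (n - j)) / fact n"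
  let ?L = "exp (- \<theta> k / real k)"
  have pos: "\<forall>\<^sub>F n in sequentially. perm_norm \<theta> n > 0"
    by (rule eventually_perm_norm_pos[OF _ ratio]) (rule theta_nonneg)
  have "?\<beta> i \<ge> 0" for i
    using theta_nonneg by (intro weight_coeff_nonneg) auto
  then have "\<bar>?\<beta> i\<bar> \<le> perm_norm \<theta> i" for i
    using weight_coeff_removed_le by simp
  moreover have "\<bar>?u n j\<bar> \<le> 1" if "j \<le> n" for n j
    using subset_exp_mean_bounds[OF _ that, of "t / real n"] assms by (subst abs_of_nonneg) auto
  ultimately have "(\<lambda>n. (\<Sum>j\<le>n. ?u n j * (?\<alpha> j * ?\<beta> (n - j))) / perm_norm \<theta> n) \<longlonglongrightarrow>
      (\<Sum>j. ?\<phi> ^ j * ?\<alpha> j * ?L)"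
    by (rule convolution_ratio_limit[OF ratio pos _ weight_coeff_removed_limit _
          subset_exp_mean_limit[OF assms] summable_weight_coeff_single[OF k]])
  also have "(\<lambda>n. (\<Sum>j\<le>n. ?u n j * (?\<alpha> j * ?\<beta> (n - j))) / perm_norm \<theta> n) =
      (\<lambda>n. (\<Sum>p | p permutes {1..n}.
        perm_weight \<theta> n p * exp (- t * (real (cycle_sum n k p) / real n))) / (perm_norm \<theta> n * fact n))"
  proof
    fix n
    have "(\<Sum>p | p permutes {1..n}. perm_weight \<theta> n p * exp (- t * (real (cycle_sum n k p) / real n))) =
        (\<Sum>j\<le>n. ?u n j * (?\<alpha> j * ?\<beta> (n - j))) * fact n"
      using sum_perm_weight_exp[OF k, of \<theta> n "t / real n"] by (simp add: sum_distrib_right)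
    then show "(\<Sum>j\<le>n. ?u n j * (?\<alpha> j * ?\<beta> (n - j))) / perm_norm \<theta> n =
        (\<Sum>p | p permutes {1..n}.
          perm_weight \<theta> n p * exp (- t * (real (cycle_sum n k p) / real n))) / (perm_norm \<theta> n * fact n)"
      by simp
  qed
  also have "(\<Sum>j. ?\<phi> ^ j * ?\<alpha> j * ?L) = exp (\<theta> k / real k * ?\<phi> ^ k) * ?L"
    using sums_unique[OF sums_mult2[OF weight_coeff_single_sums[OF k, of "\<theta> k" ?\<phi>], of ?L]]
    by (simp add: mult.commute[of "?\<phi> ^ _"])
  also have "\<dots> = exp (\<theta> k / real k * (?\<phi> ^ k - 1))"
    by (simp add: exp_add[symmetric] algebra_simps)
  finally show ?thesis .
qed

end

section \<open>Continuity theorem for Laplace transforms\<close>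

lemma char_moment_approx:
  assumes "real_distribution M" "AE x in M. 0 \<le> x \<and> x \<le> (1::real)"
  shows "cmod (char M t - (\<Sum>k\<le>n. (\<i> * t) ^ k / fact k * complex_of_real (LINT x|M. x ^ k))) \<le>
    2 * \<bar>t\<bar> ^ n / fact n"
proof -
  interpret real_distribution M by fact
  have bound: "AE x in M. norm (x ^ k) \<le> 1" for k
    using assms(2) by eventually_elim (auto simp: power_abs power_le_one)
  have int: "integrable M (\<lambda>x. x ^ k)" for k
    using bound by (rule integrable_const_bound) auto
  have "expectation (\<lambda>x. \<bar>x\<bar> ^ n) \<le> expectation (\<lambda>x. 1)"
    using bound[of n] integrable_abs[OF int[of n]]
    by (intro integral_mono_AE) (auto simp: power_abs)
  then have "(2 * \<bar>t\<bar> ^ n / fact n) * expectation (\<lambda>x. \<bar>x\<bar> ^ n) \<le> 2 * \<bar>t\<bar> ^ n / fact n"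
    using prob_space by (intro mult_left_le) auto
  with char_approx1[OF int, where t = t and n = n] show ?thesis
    by (rule order_trans)
qed

text \<open>On the unit interval all moments are at most 1, so the Taylor remainder of the
  characteristic function at a fixed \<open>t\<close> is small uniformly over all the laws. A fixed
  Taylor polynomial involves finitely many moments, and these converge.\<close>

lemma char_tendsto_moments:
  assumes \<mu>: "\<And>n. real_distribution (\<mu> n)" "\<And>n. AE x in \<mu> n. 0 \<le> x \<and> x \<le> (1::real)"
    and \<nu>: "real_distribution \<nu>" "AE x in \<nu>. 0 \<le> x \<and> x \<le> 1"
    and lim: "\<And>k. (\<lambda>n. LINT x|\<mu> n. x ^ k) \<longlonglongrightarrow> (LINT x|\<nu>. x ^ k)"
  shows "(\<lambda>n. char (\<mu> n) t) \<longlonglongrightarrow> char \<nu> t"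
proof (rule tendstoI)
  fix e :: real assume "e > 0"
  have "(\<lambda>N. \<bar>t\<bar> ^ N / fact N) \<longlonglongrightarrow> 0"
    using summable_LIMSEQ_zero[OF summable_exp[of "\<bar>t\<bar>"]] by (simp add: divide_inverse mult.commute)
  then have "(\<lambda>N. 2 * (\<bar>t\<bar> ^ N / fact N)) \<longlonglongrightarrow> 2 * 0"
    by (intro tendsto_mult tendsto_const)
  then have "\<forall>\<^sub>F N in sequentially. 2 * (\<bar>t\<bar> ^ N / fact N) < e / 3"
    using \<open>e > 0\<close> by (intro order_tendstoD) auto
  then obtain N where N: "2 * \<bar>t\<bar> ^ N / fact N < e / 3"
    by (auto simp: eventually_at_top_linorder)
  let ?T = "\<lambda>M. \<Sum>k\<le>N. (\<i> * t) ^ k / fact k * complex_of_real (LINT x|M. x ^ k)"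
  have "(\<lambda>n. ?T (\<mu> n)) \<longlonglongrightarrow> ?T \<nu>"
    by (intro tendsto_sum tendsto_mult tendsto_const tendsto_of_real lim)
  then have "\<forall>\<^sub>F n in sequentially. dist (?T (\<mu> n)) (?T \<nu>) < e / 3"
    using \<open>e > 0\<close> by (intro tendstoD) auto
  then show "\<forall>\<^sub>F n in sequentially. dist (char (\<mu> n) t) (char \<nu> t) < e"
  proof eventually_elim
    case (elim n)
    have "dist (char (\<mu> n) t) (?T (\<mu> n)) < e / 3" "dist (char \<nu> t) (?T \<nu>) < e / 3"
      using char_moment_approx[OF \<mu>, of n t N] char_moment_approx[OF \<nu>, of t N] N
      by (simp_all add: dist_norm)
    with elim show ?case
      by (smt (verit) dist_commute dist_triangle_third)
  qed
qed

abbreviation exp_neg_distr :: "real measure \<Rightarrow> real measure" where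
  "exp_neg_distr M \<equiv> distr M borel (\<lambda>x. exp (- x))"

text \<open>Since exp (- x) is strictly decreasing, lower half-lines correspond to upper ones and
  atoms to atoms, so distribution functions can be recovered from the image law.\<close>

lemma exp_neg_distr:
  assumes "real_distribution M" "AE x in M. x \<ge> 0"
  shows "real_distribution (exp_neg_distr M)"
    and "AE y in exp_neg_distr M. 0 \<le> y \<and> y \<le> 1"
    and "(LINT y|exp_neg_distr M. y ^ k) = (LINT x|M. exp (- real k * x))"
    and "measure (exp_neg_distr M) {exp (- x)..} = measure M {..x}"
    and "measure (exp_neg_distr M) {exp (- x)} = measure M {x}"
proof -
  interpret real_distribution M by fact
  show "real_distribution (exp_neg_distr M)"
    by (rule real_distribution_distr) simp
  show "AE y in exp_neg_distr M. 0 \<le> y \<and> y \<le> 1"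
    by (subst AE_distr_iff) (use assms(2) in auto)
  show "(LINT y|exp_neg_distr M. y ^ k) = (LINT x|M. exp (- real k * x))"
    by (subst integral_distr) (auto simp: exp_of_nat_mult[symmetric])
  show "measure (exp_neg_distr M) {exp (- x)..} = measure M {..x}"
    by (subst measure_distr) (auto intro!: arg_cong[where f = "measure M"])
  show "measure (exp_neg_distr M) {exp (- x)} = measure M {x}"
    by (subst measure_distr) (auto intro!: arg_cong[where f = "measure M"])
qed

text \<open>On the half-line, the Laplace transform at the positive integers gives the moments of
  \<open>exp (- X)\<close>, which is supported in the unit interval.\<close>

lemma char_exp_neg_tendsto:
  assumes \<mu>: "\<And>n. real_distribution (\<mu> n)" "\<And>n. AE x in \<mu> n. x \<ge> 0"
    and \<nu>: "real_distribution \<nu>" "AE x in \<nu>. x \<ge> 0"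
    and lim: "\<And>t. t > 0 \<Longrightarrow> (\<lambda>n. LINT x|\<mu> n. exp (- t * x)) \<longlonglongrightarrow> (LINT x|\<nu>. exp (- t * x))"
  shows "(\<lambda>n. char (exp_neg_distr (\<mu> n)) t) \<longlonglongrightarrow> char (exp_neg_distr \<nu>) t"
proof (rule char_tendsto_moments)
  fix k
  \<comment> \<open>The moment of order 0 would be the transform at t = 0, outside the hypothesis;
    it is the total mass instead.\<close>
  have 1: "measure M (space M) = 1" if "real_distribution M" for M
  proof -
    interpret real_distribution M by fact
    show ?thesis
      by (rule prob_space)
  qed
  show "(\<lambda>n. LINT x|exp_neg_distr (\<mu> n). x ^ k) \<longlonglongrightarrow> (LINT x|exp_neg_distr \<nu>. x ^ k)"
    unfolding exp_neg_distr(3)[OF \<mu>] exp_neg_distr(3)[OF \<nu>]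
    using lim[of "real k"] by (cases "k = 0") (auto simp: 1 \<mu> \<nu>)
qed (rule exp_neg_distr(1,2)[OF \<mu>] exp_neg_distr(1,2)[OF \<nu>])+

text \<open>Levy's theorem gives weak convergence of the laws of exp (- X), and the distribution
  functions are then pulled back through continuity sets.\<close>

lemma laplace_weak_conv:
  assumes \<mu>: "\<And>n. real_distribution (\<mu> n)" "\<And>n. AE x in \<mu> n. x \<ge> 0"
    and \<nu>: "real_distribution \<nu>" "AE x in \<nu>. x \<ge> 0"
    and lim: "\<And>t. t > 0 \<Longrightarrow> (\<lambda>n. LINT x|\<mu> n. exp (- t * x)) \<longlonglongrightarrow> (LINT x|\<nu>. exp (- t * x))"
  shows "weak_conv_m \<mu> \<nu>"
  unfolding weak_conv_m_def weak_conv_def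
proof (intro allI impI)
  fix x assume "isCont (cdf \<nu>) x"
  interpret \<nu>: real_distribution \<nu> by fact
  interpret E: real_distribution "exp_neg_distr \<nu>"
    by (rule exp_neg_distr(1)[OF \<nu>])
  \<comment> \<open>A continuity point of the distribution function carries no atom, so the boundary
    point of the half-line is null for the image law.\<close>
  have "measure (exp_neg_distr \<nu>) {exp (- x)} = 0"
    using \<open>isCont (cdf \<nu>) x\<close> by (simp add: exp_neg_distr(5)[OF \<nu>] \<nu>.isCont_cdf)
  then have "emeasure (exp_neg_distr \<nu>) (frontier {exp (- x)..}) = 0"
    by (simp add: E.emeasure_eq_measure)
  moreover have "weak_conv_m (\<lambda>n. exp_neg_distr (\<mu> n)) (exp_neg_distr \<nu>)"
    by (intro levy_continuity exp_neg_distr(1) \<mu> \<nu> char_exp_neg_tendsto lim)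
  ultimately have "(\<lambda>n. measure (exp_neg_distr (\<mu> n)) {exp (- x)..}) \<longlonglongrightarrow> measure (exp_neg_distr \<nu>) {exp (- x)..}"
    by (intro weak_conv_imp_continuity_set_conv exp_neg_distr(1) \<mu> \<nu>) auto
  then show "(\<lambda>n. cdf (\<mu> n) x) \<longlonglongrightarrow> cdf \<nu> x"
    by (simp add: exp_neg_distr(4) \<mu> \<nu> cdf_def)
qed

lemma laplace_unique:
  assumes \<mu>: "real_distribution \<mu>" "AE x in \<mu>. x \<ge> 0"
    and \<nu>: "real_distribution \<nu>" "AE x in \<nu>. x \<ge> 0"
    and eq: "\<And>t. t > 0 \<Longrightarrow> (LINT x|\<mu>. exp (- t * x)) = (LINT x|\<nu>. exp (- t * x))"
  shows "\<mu> = \<nu>"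
proof -
  \<comment> \<open>Uniqueness is the convergence statement for a constant sequence.\<close>
  have "(\<lambda>_::nat. char (exp_neg_distr \<mu>) t) \<longlonglongrightarrow> char (exp_neg_distr \<nu>) t" for t
    using \<mu> \<nu> by (rule char_exp_neg_tendsto) (subst eq, auto)
  then have "char (exp_neg_distr \<mu>) = char (exp_neg_distr \<nu>)"
    by (auto simp: fun_eq_iff LIMSEQ_const_iff)
  then have "exp_neg_distr \<mu> = exp_neg_distr \<nu>"
    by (intro Levy_uniqueness exp_neg_distr(1) \<mu> \<nu>)
  then have "cdf \<mu> = cdf \<nu>"
    using exp_neg_distr(4)[OF \<mu>] exp_neg_distr(4)[OF \<nu>] by (simp add: fun_eq_iff cdf_def)
  then show ?thesis
    by (rule cdf_unique[OF \<mu>(1) \<nu>(1)])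
qed

text \<open>A Markov bound: on {..-e} the integrand is at least exp (t e), so this half-line has
  mass at most exp (- t e), which vanishes as t grows.\<close>

lemma AE_nonneg_if_laplace_le_1:
  assumes "real_distribution M"
    and int: "\<And>t. t > 0 \<Longrightarrow> integrable M (\<lambda>x. exp (- t * x))"
    and le: "\<And>t. t > 0 \<Longrightarrow> (LINT x|M. exp (- t * x)) \<le> 1"
  shows "AE x in M. x \<ge> (0::real)"
proof -
  interpret real_distribution M by fact
  have zero: "measure M {..-e} = 0" if "e > 0" for e
  proof -
    have "measure M {..-e} \<le> exp (- real (Suc n) * e)" for n
    proof -
      let ?t = "real (Suc n)"
      have "exp (?t * e) * measure M {..-e} = (LINT x|M. exp (?t * e) * indicator {..-e} x)"
        by simp
      also have "\<dots> \<le> (LINT x|M. exp (- ?t * x))"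
      proof (intro integral_mono int)
        fix x
        have "?t * e \<le> - ?t * x" if "x \<le> - e"
          using mult_left_mono[of e "- x" ?t] that by (simp add: algebra_simps)
        then show "exp (?t * e) * indicator {..-e} x \<le> exp (- ?t * x)"
          by (auto split: split_indicator)
      qed (auto simp: emeasure_eq_measure)
      also have "\<dots> \<le> 1"
        by (rule le) simp
      finally have "exp (- (?t * e)) * (exp (?t * e) * measure M {..-e}) \<le> exp (- (?t * e)) * 1"
        by (intro mult_left_mono) auto
      then show ?thesis
        by (simp add: mult.assoc[symmetric] exp_add[symmetric] del: of_nat_Suc)
    qed
    moreover have "(\<lambda>n. exp (- real (Suc n) * e)) \<longlonglongrightarrow> 0"
      using that by real_asymp
    ultimately have "measure M {..-e} \<le> 0"
      by (intro LIMSEQ_le_const) auto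
    then show ?thesis
      using measure_nonneg[of M "{..-e}"] by linarith
  qed
  have "AE x in M. x \<notin> {..- inverse (real (Suc n))}" for n
    by (rule AE_not_in) (simp add: null_sets_def emeasure_eq_measure zero del: of_nat_Suc)
  then have "AE x in M. \<forall>n. x \<notin> {..- inverse (real (Suc n))}"
    unfolding AE_all_countable ..
  then show ?thesis
  proof eventually_elim
    case (elim x)
    show ?case
    proof (rule ccontr)
      assume "\<not> x \<ge> 0"
      then obtain n where "inverse (real (Suc n)) < - x"
        using reals_Archimedean[of "- x"] by auto
      with elim show False
        by (auto simp: not_le dest!: spec[of _ n])
    qed
  qed
qed

text \<open>The Bochner integral of a function that is not integrable is 0 by convention. Since the
  prescribed transform is positive, integrability can be inferred from its value.\<close>

lemma integrable_if_integral_nonzero: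
  fixes f :: "'a \<Rightarrow> real"
  assumes "integral\<^sup>L M f \<noteq> 0"
  shows "integrable M f"
  using assms not_integrable_integral_eq by blast

lemma one_minus_exp_div_bounds:
  assumes "(t::real) > 0"
  shows "0 < (1 - exp (- t)) / t" "(1 - exp (- t)) / t \<le> 1"
proof -
  have "1 - t \<le> exp (- t)"
    using exp_ge_add_one_self[of "- t"] by simp
  then show "0 < (1 - exp (- t)) / t" "(1 - exp (- t)) / t \<le> 1"
    using assms by simp_all
qed

lemma cycle_sum_limit_law_nonneg:
  assumes "cycle_sum_limit_law \<theta> k \<nu>" "\<theta> k \<ge> 0"
  shows "AE x in \<nu>. x \<ge> 0"
proof (rule AE_nonneg_if_laplace_le_1)
  show "real_distribution \<nu>"
    using assms(1) by (simp add: cycle_sum_limit_law_def)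
  fix t :: real assume t: "t > 0"
  have eq: "(LINT x|\<nu>. exp (- t * x)) = exp (\<theta> k / real k * (((1 - exp (- t)) / t) ^ k - 1))"
    using assms(1) t by (simp add: cycle_sum_limit_law_def)
  then show "integrable \<nu> (\<lambda>x. exp (- t * x))"
    by (intro integrable_if_integral_nonzero) (simp only: exp_not_eq_zero not_False_eq_True)
  have "((1 - exp (- t)) / t) ^ k \<le> 1"
    using one_minus_exp_div_bounds[OF t] by (intro power_le_one) auto
  then have "\<theta> k / real k * (((1 - exp (- t)) / t) ^ k - 1) \<le> 0"
    using assms(2) by (intro mult_nonneg_nonpos) auto
  then show "(LINT x|\<nu>. exp (- t * x)) \<le> 1"
    unfolding eq by simp
qed

lemma cycle_sum_limit_law_unique:
  assumes "cycle_sum_limit_law \<theta> k \<mu>" "cycle_sum_limit_law \<theta> k \<nu>" "\<theta> k \<ge> 0"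
  shows "\<mu> = \<nu>"
proof (rule laplace_unique)
  show "(LINT x|\<mu>. exp (- t * x)) = (LINT x|\<nu>. exp (- t * x))" if "t > 0" for t
    using assms(1,2) that by (simp add: cycle_sum_limit_law_def)
qed (use assms cycle_sum_limit_law_nonneg in \<open>auto simp: cycle_sum_limit_law_def\<close>)

section \<open>The limit law\<close>

abbreviation uniform01 :: "real measure" where
  "uniform01 \<equiv> uniform_measure lborel {0..1}"

fun uniform_sum :: "nat \<Rightarrow> real measure" where
  "uniform_sum 0 = return borel 0"
| "uniform_sum (Suc m) = convolution uniform01 (uniform_sum m)"

lemma real_distribution_uniform01: "real_distribution uniform01"
  by (intro real_distribution.intro real_distribution_axioms.intro prob_space_uniform_measure) auto

lemma real_distribution_convolution:
  assumes "real_distribution M" "real_distribution N"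
  shows "real_distribution (convolution M N)"
proof -
  interpret M: real_distribution M by fact
  interpret N: real_distribution N by fact
  interpret pair_prob_space M N ..
  show ?thesis
    unfolding convolution_def by (rule P.real_distribution_distr) simp
qed

lemma real_distribution_uniform_sum: "real_distribution (uniform_sum m)"
proof (induction m)
  case 0
  show ?case
    by (auto intro!: real_distribution.intro real_distribution_axioms.intro prob_space_return)
qed (simp add: real_distribution_convolution real_distribution_uniform01)

lemma nn_integral_uniform01:
  assumes [measurable]: "f \<in> borel_measurable borel"
  shows "(\<integral>\<^sup>+x. f x \<partial>uniform01) = (\<integral>\<^sup>+x. f x * indicator {0..1} x \<partial>lborel)"
  by (subst nn_integral_uniform_measure) (auto simp: divide_ennreal_def)

text \<open>The transform is multiplicative under convolution, and one uniform variable contributes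
  (1 - exp (- t)) / t.\<close>

lemma nn_integral_exp_uniform_sum:
  assumes "t > 0"
  shows "(\<integral>\<^sup>+x. ennreal (exp (- t * x)) \<partial>uniform_sum m) = ennreal (((1 - exp (- t)) / t) ^ m)"
proof (induction m)
  case 0
  show ?case
    by (simp add: nn_integral_return)
next
  case (Suc m)
  interpret U: real_distribution uniform01 by (rule real_distribution_uniform01)
  interpret S: real_distribution "uniform_sum m" by (rule real_distribution_uniform_sum)
  let ?\<phi> = "(1 - exp (- t)) / t"
  have "((\<lambda>x. - exp (- t * x) / t) has_real_derivative exp (- t * x)) (at x)" for x
    using assms by (auto intro!: derivative_eq_intros)
  then have "(\<integral>\<^sup>+x. ennreal (exp (- t * x)) * indicator {0..1} x \<partial>lborel) =
      ennreal (- exp (- t * 1) / t - (- exp (- t * 0) / t))"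
    by (intro nn_integral_FTC_Icc) auto
  also have "- exp (- t * 1) / t - (- exp (- t * 0) / t) = ?\<phi>"
    by (simp add: diff_divide_distrib)
  finally have U: "(\<integral>\<^sup>+x. ennreal (exp (- t * x)) \<partial>uniform01) = ennreal ?\<phi>"
    by (subst nn_integral_uniform01) auto
  have "(\<integral>\<^sup>+x. ennreal (exp (- t * x)) \<partial>uniform_sum (Suc m)) =
      (\<integral>\<^sup>+x. \<integral>\<^sup>+y. ennreal (exp (- t * x)) * ennreal (exp (- t * y)) \<partial>uniform_sum m \<partial>uniform01)"
    unfolding uniform_sum.simps
    by (subst nn_integral_convolution)
      (auto simp: U.finite_measure_axioms S.finite_measure_axioms ennreal_mult[symmetric] exp_add[symmetric]
        algebra_simps)
  also have "\<dots> = (\<integral>\<^sup>+x. ennreal (exp (- t * x)) * ennreal (?\<phi> ^ m) \<partial>uniform01)"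
    unfolding Suc.IH[symmetric] by (intro nn_integral_cong nn_integral_cmult) auto
  also have "\<dots> = ennreal ?\<phi> * ennreal (?\<phi> ^ m)"
    unfolding U[symmetric] by (rule nn_integral_multc) auto
  also have "\<dots> = ennreal (?\<phi> ^ Suc m)"
    using one_minus_exp_div_bounds[OF assms] by (simp add: ennreal_mult[symmetric])
  finally show ?case .
qed

text \<open>\<open>poisson_pmf\<close> is specified for positive rates only.\<close>

definition poisson_law :: "real \<Rightarrow> nat pmf" where
  "poisson_law r = (if r = 0 then return_pmf 0 else poisson_pmf r)"

lemma pmf_poisson_law:
  assumes "r \<ge> 0"
  shows "pmf (poisson_law r) N = r ^ N / fact N * exp (- r)"
  using assms by (cases "N = 0") (auto simp: poisson_law_def)

definition poisson_uniform_sum :: "nat \<Rightarrow> real \<Rightarrow> real measure" where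
  "poisson_uniform_sum k r = measure_pmf (poisson_law r) \<bind> (\<lambda>N. uniform_sum (k * N))"

lemma uniform_sum_kernel:
  "(\<lambda>N. uniform_sum (k * N)) \<in> measurable (measure_pmf p) (subprob_algebra borel)"
proof -
  have "uniform_sum m \<in> space (subprob_algebra borel)" for m
  proof -
    interpret real_distribution "uniform_sum m" by (rule real_distribution_uniform_sum)
    show ?thesis
      by (simp add: space_subprob_algebra prob_space_imp_subprob_space prob_space_axioms)
  qed
  then show ?thesis by simp
qed

lemma nn_integral_poisson_law:
  assumes "r \<ge> 0"
  shows "(\<integral>\<^sup>+N. f N \<partial>measure_pmf (poisson_law r)) = (\<Sum>N. ennreal (r ^ N / fact N * exp (- r)) * f N)"
  by (simp add: nn_integral_measure_pmf nn_integral_count_space_nat pmf_poisson_law assms)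

lemma real_distribution_poisson_uniform_sum: "real_distribution (poisson_uniform_sum k r)"
proof (intro real_distribution.intro real_distribution_axioms.intro)
  show "prob_space (poisson_uniform_sum k r)"
    unfolding poisson_uniform_sum_def
    by (rule measure_pmf.prob_space_bind[OF _ uniform_sum_kernel])
      (simp add: real_distribution.axioms(1)[OF real_distribution_uniform_sum])
  show "sets (poisson_uniform_sum k r) = sets borel"
    unfolding poisson_uniform_sum_def
    by (rule sets_bind) (auto simp: real_distribution.events_eq_borel[OF real_distribution_uniform_sum])
qed

text \<open>The transform is the Poisson generating function, E z^N = exp (r (z - 1)), at z =
  \<open>\<phi>\<close> ^ k. This supplies existence of the limit law.\<close>

lemma cycle_sum_limit_law_poisson_uniform_sum:
  assumes "\<theta> k \<ge> 0"
  shows "cycle_sum_limit_law \<theta> k (poisson_uniform_sum k (\<theta> k / real k))"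
  unfolding cycle_sum_limit_law_def
proof (intro conjI allI impI)
  define r where "r = \<theta> k / real k"
  show "real_distribution (poisson_uniform_sum k (\<theta> k / real k))"
    by (rule real_distribution_poisson_uniform_sum)
  then interpret real_distribution "poisson_uniform_sum k (\<theta> k / real k)" .
  fix t :: real assume t: "t > 0"
  define \<phi> where "\<phi> = (1 - exp (- t)) / t"
  have \<phi>: "0 < \<phi>" and r: "r \<ge> 0"
    using one_minus_exp_div_bounds[OF t] assms by (auto simp: \<phi>_def r_def)
  have "(\<integral>\<^sup>+x. ennreal (exp (- t * x)) \<partial>poisson_uniform_sum k r) =
      (\<integral>\<^sup>+N. \<integral>\<^sup>+x. ennreal (exp (- t * x)) \<partial>uniform_sum (k * N) \<partial>measure_pmf (poisson_law r))"
    unfolding poisson_uniform_sum_def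
    by (rule nn_integral_bind[OF _ uniform_sum_kernel]) simp
  also have "\<dots> = (\<Sum>N. ennreal (r ^ N / fact N * exp (- r)) * ennreal (\<phi> ^ (k * N)))"
    unfolding nn_integral_exp_uniform_sum[OF t] \<phi>_def[symmetric] by (rule nn_integral_poisson_law[OF r])
  also have "\<dots> = (\<Sum>N. ennreal ((r * \<phi> ^ k) ^ N /\<^sub>R fact N * exp (- r)))"
    using \<phi> r
    by (intro suminf_cong, subst ennreal_mult[symmetric])
      (auto simp: power_mult[of \<phi> k] power_mult_distrib divide_inverse)
  also have "\<dots> = ennreal (exp (r * \<phi> ^ k) * exp (- r))"
    using \<phi> r by (intro suminf_ennreal_eq sums_mult2 exp_converges) auto
  also have "exp (r * \<phi> ^ k) * exp (- r) = exp (r * (\<phi> ^ k - 1))"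
    by (simp add: exp_add[symmetric] algebra_simps)
  finally show "(LINT x|poisson_uniform_sum k (\<theta> k / real k). exp (- t * x)) =
      exp (\<theta> k / real k * (((1 - exp (- t)) / t) ^ k - 1))"
    unfolding r_def[symmetric] \<phi>_def[symmetric] by (subst integral_eq_nn_integral) (auto simp: r_def)
qed

section \<open>Irwin-Hall distribution functions\<close>

definition pos_power :: "nat \<Rightarrow> real \<Rightarrow> real" where
  "pos_power m y = (if y < 0 then 0 else y ^ m / fact m)"

text \<open>The inclusion-exclusion formula for the distribution function of a sum of m uniform
  variables, with 1 / m! kept inside the truncated powers. As 0^0 = 1, \<open>pos_power\<close> 0 is
  right-continuous at 0, so m = 0 gives the point mass at 0.\<close>

definition irwin_hall :: "nat \<Rightarrow> real \<Rightarrow> real" where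
  "irwin_hall m x = (\<Sum>j\<le>m. (-1) ^ j * real (m choose j) * pos_power m (x - real j))"

text \<open>The origin is excluded because \<open>pos_power\<close> 1 has a kink there.\<close>

lemma pos_power_deriv:
  assumes "y \<noteq> 0"
  shows "(pos_power (Suc m) has_real_derivative pos_power m y) (at y)"
proof (cases "y < 0")
  case True
  have "((\<lambda>_. 0) has_real_derivative 0) (at y)"
    by simp
  then have "(pos_power (Suc m) has_real_derivative 0) (at y)"
    by (rule has_field_derivative_transform_within_open[where S = "{..<0}"])
      (use True in \<open>auto simp: pos_power_def\<close>)
  then show ?thesis
    using True by (simp add: pos_power_def)
next
  case False
  have "((\<lambda>y. y ^ Suc m / fact (Suc m)) has_real_derivative (real (Suc m) * y ^ m) / fact (Suc m)) (at y)"
    using DERIV_cdivide[OF DERIV_pow[of "Suc m" y], of "fact (Suc m)"]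
    by (simp del: fact_Suc of_nat_Suc power_Suc)
  also have "(real (Suc m) * y ^ m) / fact (Suc m) = y ^ m / fact m"
    by (simp del: of_nat_Suc)
  finally have "(pos_power (Suc m) has_real_derivative y ^ m / fact m) (at y)"
    by (rule has_field_derivative_transform_within_open[where S = "{0<..}"])
      (use False assms in \<open>auto simp: pos_power_def\<close>)
  then show ?thesis
    using False by (simp add: pos_power_def)
qed

lemma continuous_on_pos_power: "continuous_on A (pos_power (Suc m))"
proof -
  have "pos_power (Suc m) = (\<lambda>y. max 0 y ^ Suc m / fact (Suc m))"
    by (auto simp: pos_power_def max_def fun_eq_iff)
  then show ?thesis
    by (simp only:) (intro continuous_intros, auto)
qed

lemma pos_power_has_integral:
  "((\<lambda>u. pos_power m (z - u)) has_integral (pos_power (Suc m) z - pos_power (Suc m) (z - 1))) {0..1}"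
proof -
  have "((\<lambda>u. pos_power m (z - u)) has_integral
      (- pos_power (Suc m) (z - 1) - (- pos_power (Suc m) (z - 0)))) {0..1}"
  \<comment> \<open>At u = z the antiderivative may fail to be differentiable; one exceptional point
    is allowed since it is continuous.\<close>
  proof (rule fundamental_theorem_of_calculus_strong[where S = "{z}"])
    fix u :: real assume "u \<in> {0..1} - {z}"
    then show "((\<lambda>u. - pos_power (Suc m) (z - u)) has_vector_derivative pos_power m (z - u)) (at u)"
    proof -
      assume "u \<in> {0..1} - {z}"
      then have "(pos_power (Suc m) has_real_derivative pos_power m (z - u)) (at (z - u))"
        by (intro pos_power_deriv) auto
      moreover have "((\<lambda>u. z - u) has_real_derivative -1) (at u)"
        by (auto intro!: derivative_eq_intros)
      ultimately have "((\<lambda>u. pos_power (Suc m) (z - u)) has_real_derivative pos_power m (z - u) * -1) (at u)"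
        by (rule DERIV_chain2)
      from DERIV_minus[OF this] show ?thesis
        by (simp add: has_real_derivative_iff_has_vector_derivative)
    qed
  next
    show "continuous_on {0..1} (\<lambda>u. - pos_power (Suc m) (z - u))"
      by (intro continuous_intros continuous_on_compose2[OF continuous_on_pos_power[of UNIV]]) auto
  qed auto
  then show ?thesis by simp
qed

text \<open>With E the shift Q j -> Q (j + 1), this says that the m-th power of 1 - E applied to (1
  - E) Q is the power m + 1 applied to Q; in coefficients it is Pascal's rule.\<close>

lemma alternating_binomial_diff:
  fixes Q :: "nat \<Rightarrow> real"
  shows "(\<Sum>j\<le>m. (-1) ^ j * real (m choose j) * (Q j - Q (Suc j))) =
    (\<Sum>j\<le>Suc m. (-1) ^ j * real (Suc m choose j) * Q j)"
proof -
  have "(\<Sum>j\<le>m. (-1) ^ j * real (m choose j) * Q j) =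
      (\<Sum>j\<le>Suc m. (-1) ^ j * real (m choose j) * Q j)"
    by simp
  also have "\<dots> = Q 0 + (\<Sum>j\<le>m. (-1) ^ Suc j * real (m choose Suc j) * Q (Suc j))"
    by (subst sum.atMost_Suc_shift) simp
  finally have "(\<Sum>j\<le>m. (-1) ^ j * real (m choose j) * (Q j - Q (Suc j))) =
      Q 0 + ((\<Sum>j\<le>m. (-1) ^ Suc j * real (m choose Suc j) * Q (Suc j)) -
        (\<Sum>j\<le>m. (-1) ^ j * real (m choose j) * Q (Suc j)))"
    by (simp add: right_diff_distrib sum_subtractf)
  also have "(\<Sum>j\<le>m. (-1) ^ Suc j * real (m choose Suc j) * Q (Suc j)) -
      (\<Sum>j\<le>m. (-1) ^ j * real (m choose j) * Q (Suc j)) =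
      (\<Sum>j\<le>m. (-1) ^ Suc j * real (Suc m choose Suc j) * Q (Suc j))"
    unfolding sum_subtractf[symmetric] by (intro sum.cong refl) (simp add: algebra_simps)
  also have "Q 0 + \<dots> = (\<Sum>j\<le>Suc m. (-1) ^ j * real (Suc m choose j) * Q j)"
    unfolding sum.atMost_Suc_shift by simp
  finally show ?thesis .
qed

lemma irwin_hall_has_integral:
  "((\<lambda>u. irwin_hall m (x - u)) has_integral irwin_hall (Suc m) x) {0..1}"
proof -
  let ?Q = "\<lambda>j. pos_power (Suc m) (x - real j)"
  have "((\<lambda>u. irwin_hall m (x - u)) has_integral
      (\<Sum>j\<le>m. (-1) ^ j * real (m choose j) * (?Q j - ?Q (Suc j)))) {0..1}"
    unfolding irwin_hall_def
  proof (intro has_integral_sum has_integral_mult_right)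
    fix j
    show "((\<lambda>u. pos_power m (x - u - real j)) has_integral (?Q j - ?Q (Suc j))) {0..1}"
      using pos_power_has_integral[of m "x - real j"] by (simp add: algebra_simps)
  qed simp
  then show ?thesis
    unfolding alternating_binomial_diff[of m ?Q] irwin_hall_def .
qed

text \<open>Conditioning on one uniform variable averages the previous distribution function over a
  unit window, which is the integral recursion of \<open>irwin_hall\<close>. Nonnegativity of
  \<open>irwin_hall\<close> comes from the induction hypothesis, since the alternating sum does not
  show it.\<close>

lemma measure_uniform_sum_atMost: "measure (uniform_sum m) {..x} = irwin_hall m x"
proof (induction m arbitrary: x)
  case 0
  show ?case
    by (simp add: measure_return irwin_hall_def pos_power_def indicator_def)
next
  case (Suc m)
  interpret U: real_distribution uniform01 by (rule real_distribution_uniform01)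
  interpret S: real_distribution "uniform_sum m" by (rule real_distribution_uniform_sum)
  interpret T: real_distribution "uniform_sum (Suc m)" by (rule real_distribution_uniform_sum)
  have nonneg: "irwin_hall m y \<ge> 0" for y
    by (simp add: Suc.IH[symmetric])
  have [measurable]: "(\<lambda>u. ennreal (irwin_hall m (x - u))) \<in> borel_measurable borel"
    unfolding irwin_hall_def pos_power_def by measurable
  have "{a. a + u \<le> x} = {..x - u}" for u
    by auto
  then have "emeasure (uniform_sum (Suc m)) {..x} = (\<integral>\<^sup>+u. ennreal (irwin_hall m (x - u)) \<partial>uniform01)"
    unfolding uniform_sum.simps
    by (subst convolution_emeasure)
      (auto simp: U.finite_measure_axioms S.finite_measure_axioms S.emeasure_eq_measure Suc.IH)
  also have "\<dots> = (\<integral>\<^sup>+u. indicator {0..1} u * ennreal (irwin_hall m (x - u)) \<partial>lborel)"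
    by (subst nn_integral_uniform01) (auto simp: mult.commute)
  also have "\<dots> = ennreal (irwin_hall (Suc m) x)"
    using nn_integral_has_integral_lebesgue[OF nonneg irwin_hall_has_integral[of m x]]
    by (simp add: ennreal_mult' ennreal_indicator)
  finally have "ennreal (measure (uniform_sum (Suc m)) {..x}) = ennreal (irwin_hall (Suc m) x)"
    by (simp only: T.emeasure_eq_measure)
  moreover have "irwin_hall (Suc m) x \<ge> 0"
    using has_integral_nonneg[OF irwin_hall_has_integral] nonneg by blast
  ultimately show ?case
    by simp
qed

section \<open>Resummation of the Poisson mixture into Bessel functions\<close>

lemma poisson_uniform_sum_atMost_sums:
  assumes "r \<ge> 0"
  shows "(\<lambda>m. r ^ m / fact m * exp (- r) * irwin_hall m x) sums measure (poisson_uniform_sum 1 r) {..x}"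
proof -
  interpret real_distribution "poisson_uniform_sum 1 r"
    by (rule real_distribution_poisson_uniform_sum)
  have S: "emeasure (uniform_sum m) {..x} = ennreal (irwin_hall m x)" and nonneg: "irwin_hall m x \<ge> 0" for m
  proof -
    interpret S: real_distribution "uniform_sum m" by (rule real_distribution_uniform_sum)
    show "emeasure (uniform_sum m) {..x} = ennreal (irwin_hall m x)" "irwin_hall m x \<ge> 0"
      by (simp_all add: S.emeasure_eq_measure measure_uniform_sum_atMost[symmetric])
  qed
  have "emeasure (poisson_uniform_sum 1 r) {..x} =
      (\<integral>\<^sup>+N. emeasure (uniform_sum (1 * N)) {..x} \<partial>measure_pmf (poisson_law r))"
    unfolding poisson_uniform_sum_def by (rule emeasure_bind[OF _ uniform_sum_kernel]) auto
  also have "\<dots> = (\<Sum>m. ennreal (r ^ m / fact m * exp (- r)) * ennreal (irwin_hall m x))"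
    by (simp add: S nn_integral_poisson_law assms)
  also have "\<dots> = (\<Sum>m. ennreal (r ^ m / fact m * exp (- r) * irwin_hall m x))"
    using nonneg assms by (intro suminf_cong ennreal_mult[symmetric]) auto
  finally have "(\<Sum>m. ennreal (r ^ m / fact m * exp (- r) * irwin_hall m x)) =
      ennreal (measure (poisson_uniform_sum 1 r) {..x})"
    by (simp only: emeasure_eq_measure)
  then show ?thesis
    using nonneg assms by (subst sums_ennreal[symmetric]) (auto simp: sums_iff)
qed

text \<open>Bounding 1 / (l + j)! by 1 leaves an exponential series in the square of z / 2.\<close>

lemma bessel_I_sums:
  "(\<lambda>l. (z / 2) ^ (2 * l + j) / (fact l * fact (l + j))) sums bessel_I j z"
proof -
  define w where "w = \<bar>z / 2\<bar>"
  have "summable (\<lambda>l. (z / 2) ^ (2 * l + j) / (fact l * fact (l + j)))"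
  proof (rule summable_comparison_test')
    show "summable (\<lambda>l. w ^ j * (inverse (fact l) * (w\<^sup>2) ^ l))"
      by (intro summable_mult summable_exp)
    fix l :: nat
    have "norm ((z / 2) ^ (2 * l + j) / (fact l * fact (l + j))) = w ^ (2 * l + j) / (fact l * fact (l + j))"
      by (simp add: w_def power_abs)
    also have "\<dots> = (w ^ j * (inverse (fact l) * (w\<^sup>2) ^ l)) * inverse (fact (l + j))"
      unfolding power_add power_mult by (simp add: divide_inverse)
    also have "\<dots> \<le> w ^ j * (inverse (fact l) * (w\<^sup>2) ^ l)"
      by (intro mult_left_le) (auto simp: inverse_le_1_iff w_def)
    finally show "norm ((z / 2) ^ (2 * l + j) / (fact l * fact (l + j))) \<le> w ^ j * (inverse (fact l) * (w\<^sup>2) ^ l)" .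
  qed
  then show ?thesis
    unfolding bessel_I_def by (rule summable_sums)
qed

text \<open>The terms with m < j vanish through the binomial coefficient. For m = l + j the power of
  r y is l + j = (j + (2 l + j)) / 2: the part j gives the prefactor
  \<open>sqrt (r * y) ^ j\<close>, the part 2 l + j the Bessel term.\<close>

lemma poisson_binomial_bessel_sums:
  assumes "r \<ge> 0" "y \<ge> 0"
  shows "(\<lambda>m. r ^ m / fact m * (real (m choose j) * (y ^ m / fact m))) sums
    (1 / fact j * sqrt (r * y) ^ j * bessel_I j (2 * sqrt (r * y)))"
proof -
  let ?f = "\<lambda>m. r ^ m / fact m * (real (m choose j) * (y ^ m / fact m))"
  let ?s = "sqrt (r * y)"
  have "(\<lambda>l. 1 / fact j * ?s ^ j * ((2 * ?s / 2) ^ (2 * l + j) / (fact l * fact (l + j)))) sums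
      (1 / fact j * ?s ^ j * bessel_I j (2 * ?s))"
    by (intro sums_mult bessel_I_sums)
  moreover have "1 / fact j * ?s ^ j * ((2 * ?s / 2) ^ (2 * l + j) / (fact l * fact (l + j))) = ?f (l + j)" for l
  proof -
    have "?s ^ j * ?s ^ (2 * l + j) = (?s\<^sup>2) ^ (l + j)"
      by (simp add: power_add[symmetric] power_mult[symmetric] mult_2 ac_simps)
    also have "\<dots> = r ^ (l + j) * y ^ (l + j)"
      using assms by (simp add: power_mult_distrib)
    finally have s: "?s ^ j * ?s ^ (2 * l + j) = r ^ (l + j) * y ^ (l + j)" .
    have "real (l + j choose j) = fact (l + j) / (fact j * fact l)"
      by (simp add: binomial_fact)
    then show ?thesis
      using s by (simp add: field_simps)
  qed
  ultimately have "(\<lambda>l. ?f (l + j)) sums (1 / fact j * ?s ^ j * bessel_I j (2 * ?s))"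
    by simp
  then show ?thesis
    by (subst (asm) sums_zero_iff_shift) auto
qed

lemma poisson_uniform_sum_cdf:
  assumes "r \<ge> 0" "x \<ge> 0"
  shows "measure (poisson_uniform_sum 1 r) {..x} = exp (- r) *
    (\<Sum>j = 0..nat \<lfloor>x\<rfloor>. (- 1) ^ j / fact j * sqrt (r * (x - real j)) ^ j *
      bessel_I j (2 * sqrt (r * (x - real j))))"
proof -
  let ?J = "nat \<lfloor>x\<rfloor>"
  have J: "j \<le> ?J \<longleftrightarrow> real j \<le> x" for j
    using assms(2) by (simp add: le_nat_iff le_floor_iff)
  \<comment> \<open>Terms with j > m vanish by the binomial coefficient, terms with j > x by
    truncation. The range of j thus becomes independent of m, so the series over m can be summed for
    each j separately.\<close>
  have "irwin_hall m x = (\<Sum>j\<le>?J. (-1) ^ j * real (m choose j) * ((x - real j) ^ m / fact m))" for m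
    unfolding irwin_hall_def
    by (rule sum.mono_neutral_cong) (auto simp: J pos_power_def)
  then have "r ^ m / fact m * exp (- r) * irwin_hall m x = (\<Sum>j\<le>?J. exp (- r) * (-1) ^ j *
      (r ^ m / fact m * (real (m choose j) * ((x - real j) ^ m / fact m))))" for m
    by (simp add: sum_distrib_left mult_ac)
  moreover have "(\<lambda>m. \<Sum>j\<le>?J. exp (- r) * (-1) ^ j *
      (r ^ m / fact m * (real (m choose j) * ((x - real j) ^ m / fact m)))) sums
      (\<Sum>j\<le>?J. exp (- r) * (-1) ^ j *
        (1 / fact j * sqrt (r * (x - real j)) ^ j * bessel_I j (2 * sqrt (r * (x - real j)))))"
    using J assms by (intro sums_sum sums_mult poisson_binomial_bessel_sums) auto
  ultimately have "measure (poisson_uniform_sum 1 r) {..x} = (\<Sum>j\<le>?J. exp (- r) * (-1) ^ j *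
        (1 / fact j * sqrt (r * (x - real j)) ^ j * bessel_I j (2 * sqrt (r * (x - real j)))))"
    using sums_unique2[OF poisson_uniform_sum_atMost_sums[OF assms(1)]] by simp
  then show ?thesis
    by (simp add: sum_distrib_left atLeast0AtMost mult.assoc)
qed

section \<open>Weak convergence of the cycle sums\<close>

text \<open>There are finitely many permutations, so the integrand is a finite combination of
  indicators of the events that the random permutation equals a given one.\<close>

lemma expectation_random_perm:
  fixes f :: "(nat \<Rightarrow> nat) \<Rightarrow> real"
  assumes "weighted_random_perm \<theta> n M \<sigma>"
  shows "(LINT \<omega>|M. f (\<sigma> \<omega>)) =
    (\<Sum>p | p permutes {1..n}. perm_weight \<theta> n p * f p) / (perm_norm \<theta> n * fact n)"
proof -
  let ?P = "{p. p permutes {1..n}}"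
  interpret prob_space M
    using assms by (simp add: weighted_random_perm_def)
  have prob: "\<P>(\<omega> in M. \<sigma> \<omega> = p) = perm_weight \<theta> n p / (perm_norm \<theta> n * fact n)" if "p \<in> ?P" for p
    using assms that by (auto simp: weighted_random_perm_def)
  have fin: "finite ?P"
    by (simp add: finite_permutations)
  have meas: "{\<omega> \<in> space M. \<sigma> \<omega> = p} \<in> sets M" if "p \<in> ?P" for p
  proof -
    have "\<sigma> -` {p} \<inter> space M \<in> sets M"
      using assms that by (intro measurable_sets[of \<sigma> M "count_space ?P"]) (auto simp: weighted_random_perm_def)
    also have "\<sigma> -` {p} \<inter> space M = {\<omega> \<in> space M. \<sigma> \<omega> = p}"
      by auto
    finally show ?thesis .
  qed
  have "(LINT \<omega>|M. f (\<sigma> \<omega>)) = (LINT \<omega>|M. (\<Sum>p\<in>?P. f p * indicator {\<omega> \<in> space M. \<sigma> \<omega> = p} \<omega>))"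
  proof (rule Bochner_Integration.integral_cong[OF refl])
    fix \<omega> assume \<omega>: "\<omega> \<in> space M"
    have "\<sigma> \<omega> \<in> ?P"
      using assms \<omega> measurable_space[of \<sigma> M "count_space ?P"] by (simp add: weighted_random_perm_def)
    have "(\<Sum>p\<in>?P. f p * indicator {\<omega> \<in> space M. \<sigma> \<omega> = p} \<omega>) = (\<Sum>p\<in>?P. if \<sigma> \<omega> = p then f p else 0)"
      using \<omega> by (intro sum.cong refl) auto
    also have "\<dots> = f (\<sigma> \<omega>)"
      using fin \<open>\<sigma> \<omega> \<in> ?P\<close> by simp
    finally show "f (\<sigma> \<omega>) = (\<Sum>p\<in>?P. f p * indicator {\<omega> \<in> space M. \<sigma> \<omega> = p} \<omega>)" ..
  qed
  also have "\<dots> = (\<Sum>p\<in>?P. f p * measure M {\<omega> \<in> space M. \<sigma> \<omega> = p})"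
    using meas by (subst Bochner_Integration.integral_sum) (auto simp: emeasure_eq_measure)
  also have "\<dots> = (\<Sum>p\<in>?P. perm_weight \<theta> n p * f p) / (perm_norm \<theta> n * fact n)"
    unfolding sum_divide_distrib by (intro sum.cong refl) (simp add: prob)
  finally show ?thesis .
qed

theorem proposition4:
  fixes \<theta> :: "nat \<Rightarrow> real"
    and M :: "nat \<Rightarrow> 'a measure"
    and \<sigma> :: "nat \<Rightarrow> 'a \<Rightarrow> nat \<Rightarrow> nat"
  assumes theta_nonneg: "\<And>k. k \<ge> 1 \<Longrightarrow> \<theta> k \<ge> 0"
    and random_perm: "\<And>n. perm_norm \<theta> n > 0 \<Longrightarrow> weighted_random_perm \<theta> n (M n) (\<sigma> n)"
    and ratio: "(\<lambda>n. perm_norm \<theta> (n - 1) / perm_norm \<theta> n) \<longlonglongrightarrow> 1"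
  shows "(\<forall>k\<ge>1.
            (\<exists>!\<nu>. cycle_sum_limit_law \<theta> k \<nu>) \<and>
            (\<forall>\<nu>. cycle_sum_limit_law \<theta> k \<nu> \<longrightarrow>
               weak_conv_m
                 (\<lambda>n. distr (M n) borel (\<lambda>\<omega>. real (cycle_sum n k (\<sigma> n \<omega>)) / real n)) \<nu>)) \<and>
         (\<forall>\<nu>. cycle_sum_limit_law \<theta> 1 \<nu> \<longrightarrow>
            (\<forall>x\<ge>0. measure \<nu> {..x} =
               exp (- \<theta> 1) *
               (\<Sum>j = 0..nat \<lfloor>x\<rfloor>.
                  (- 1) ^ j / fact j * sqrt (\<theta> 1 * (x - real j)) ^ j *
                  bessel_I j (2 * sqrt (\<theta> 1 * (x - real j))))))"
proof (intro conjI allI impI)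
  fix k :: nat assume k: "k \<ge> 1"
  show "\<exists>!\<nu>. cycle_sum_limit_law \<theta> k \<nu>"
    using cycle_sum_limit_law_poisson_uniform_sum[of \<theta> k, OF theta_nonneg[OF k]]
      cycle_sum_limit_law_unique[of \<theta> k, OF _ _ theta_nonneg[OF k]] by blast
  fix \<nu> assume \<nu>: "cycle_sum_limit_law \<theta> k \<nu>"
  let ?X = "\<lambda>n \<omega>. real (cycle_sum n k (\<sigma> n \<omega>)) / real n"
  \<comment> \<open>\<open>M n\<close> is arbitrary where the normalization vanishes, so it is replaced there.\<close>
  define \<mu> :: "nat \<Rightarrow> real measure" where "\<mu> n = (if perm_norm \<theta> n > 0 then distr (M n) borel (?X n) else \<nu>)" for n
  have \<nu>_real: "real_distribution \<nu>"
    using \<nu> by (simp add: cycle_sum_limit_law_def)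
  have \<nu>_nonneg: "AE x in \<nu>. x \<ge> 0"
    using \<nu> theta_nonneg[OF k] by (rule cycle_sum_limit_law_nonneg)
  have X_meas: "?X n \<in> borel_measurable (M n)" and prob: "prob_space (M n)" if "perm_norm \<theta> n > 0" for n
    using random_perm[OF that]
    by (auto simp: weighted_random_perm_def intro: measurable_compose[of "\<sigma> n" _ "count_space _"])
  have \<mu>_real: "real_distribution (\<mu> n)" for n
    using \<nu>_real prob_space.real_distribution_distr[OF prob X_meas] by (simp add: \<mu>_def)
  have \<mu>_nonneg: "AE x in \<mu> n. x \<ge> 0" for n
  proof (cases "perm_norm \<theta> n > 0")
    case True
    have "AE x in distr (M n) borel (?X n). x \<ge> 0"
      by (subst AE_distr_iff[OF X_meas[OF True]]) auto
    moreover have "\<mu> n = distr (M n) borel (?X n)"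
      using True by (simp add: \<mu>_def)
    ultimately show ?thesis
      by (simp only:)
  next
    case False
    then have "\<mu> n = \<nu>"
      by (simp add: \<mu>_def)
    with \<nu>_nonneg show ?thesis
      by (simp only:)
  qed
  have pos: "\<forall>\<^sub>F n in sequentially. perm_norm \<theta> n > 0"
    by (rule eventually_perm_norm_pos[OF _ ratio]) (rule theta_nonneg)
  have lim: "(\<lambda>n. LINT x|\<mu> n. exp (- t * x)) \<longlonglongrightarrow> (LINT x|\<nu>. exp (- t * x))" if t: "t > 0" for t
  proof -
    have "(\<lambda>n. (\<Sum>p | p permutes {1..n}.
        perm_weight \<theta> n p * exp (- t * (real (cycle_sum n k p) / real n))) / (perm_norm \<theta> n * fact n))
        \<longlonglongrightarrow> (LINT x|\<nu>. exp (- t * x))"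
      using laplace_cycle_sum_limit[OF _ ratio k t] theta_nonneg \<nu> t
      by (simp add: cycle_sum_limit_law_def)
    moreover have "\<forall>\<^sub>F n in sequentially. (\<Sum>p | p permutes {1..n}.
        perm_weight \<theta> n p * exp (- t * (real (cycle_sum n k p) / real n))) / (perm_norm \<theta> n * fact n) =
        (LINT x|\<mu> n. exp (- t * x))"
      using pos
    proof eventually_elim
      case (elim n)
      have "(LINT x|\<mu> n. exp (- t * x)) = (LINT \<omega>|M n. exp (- t * ?X n \<omega>))"
        using elim X_meas[OF elim] by (simp add: \<mu>_def integral_distr)
      also have "\<dots> = (\<Sum>p | p permutes {1..n}.
          perm_weight \<theta> n p * exp (- t * (real (cycle_sum n k p) / real n))) / (perm_norm \<theta> n * fact n)"
        by (rule expectation_random_perm[OF random_perm[OF elim],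
              of "\<lambda>p. exp (- t * (real (cycle_sum n k p) / real n))"])
      finally show ?case ..
    qed
    ultimately show ?thesis
      by (rule Lim_transform_eventually)
  qed
  have "weak_conv_m \<mu> \<nu>"
    by (rule laplace_weak_conv[OF \<mu>_real \<mu>_nonneg \<nu>_real \<nu>_nonneg lim])
  \<comment> \<open>Weak convergence depends on the tail of the sequence alone, where the replaced
    laws agree with the original ones.\<close>
  have "(\<lambda>n. cdf (distr (M n) borel (?X n)) x) \<longlonglongrightarrow> cdf \<nu> x" if "isCont (cdf \<nu>) x" for x
  proof (rule Lim_transform_eventually)
    show "(\<lambda>n. cdf (\<mu> n) x) \<longlonglongrightarrow> cdf \<nu> x"
      using \<open>weak_conv_m \<mu> \<nu>\<close> that by (simp add: weak_conv_m_def weak_conv_def)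
    show "\<forall>\<^sub>F n in sequentially. cdf (\<mu> n) x = cdf (distr (M n) borel (?X n)) x"
      using pos by eventually_elim (simp add: \<mu>_def)
  qed
  then show "weak_conv_m (\<lambda>n. distr (M n) borel (?X n)) \<nu>"
    by (simp add: weak_conv_m_def weak_conv_def)
next
  fix \<nu> :: "real measure" and x :: real
  assume \<nu>: "cycle_sum_limit_law \<theta> 1 \<nu>" and x: "x \<ge> 0"
  have \<theta>: "\<theta> 1 \<ge> 0"
    by (rule theta_nonneg) simp
  have "\<nu> = poisson_uniform_sum 1 (\<theta> 1 / real 1)"
    by (rule cycle_sum_limit_law_unique[of \<theta> 1, OF \<nu> cycle_sum_limit_law_poisson_uniform_sum[of \<theta> 1, OF \<theta>] \<theta>])
  then have "\<nu> = poisson_uniform_sum 1 (\<theta> 1)"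
    by simp
  then show "measure \<nu> {..x} = exp (- \<theta> 1) *
      (\<Sum>j = 0..nat \<lfloor>x\<rfloor>. (- 1) ^ j / fact j * sqrt (\<theta> 1 * (x - real j)) ^ j *
        bessel_I j (2 * sqrt (\<theta> 1 * (x - real j))))"
    using poisson_uniform_sum_cdf[OF \<theta> x] by simp
qed

end
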